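(* Let $n\ge1$, let $\Gamma=\langle R_{-1},R_0,\dots,R_n\rangle$ be a generalized string C-group, and let $\mathcal{K}=\mathcal{K}(\Gamma)$ be the associated regular incidence complex of rank $n$. For $I\subseteq\{-1,0,\dots,n\}$ nonempty write $\Gamma_I=\langle R_k:k\in I\rangle$. (a) Let $-1\le i<j-1\le n-1$, and let $F$ be an $i$-face and $G$ a $j$-face of $\mathcal{K}$ with $F\le G$. Then the section $G/F$ is isomorphic to $\mathcal{K}(\Lambda)$, where $\Lambda=\Gamma_{\{i+1,\dots,j-1\}}$ regarded as a group with distinguished generating subgroups $R'_{-1}=R_{-1}$, $R'_k=R_{i+1+k}$ for $k=0,\dots,j-i-2$, and $R'_{j-i-1}=R_n$ (a generalized string C-group of rank $j-i-1$). (b) The facets of $\mathcal{K}$ are isomorphic to $\mathcal{K}(\Gamma_{\{-1,0,\dots,n-2,n\}})$ with distinguished generating subgroups $R_{-1},R_0,\dots,R_{n-2},R_n$, and the vertex-figures of $\mathcal{K}$ are isomorphic to $\mathcal{K}(\Gamma_{\{-1,1,\dots,n\}})$ with distinguished generating subgroups $R_{-1},R_1,\dots,R_{n-1},R_n$ (these are regular complexes of rank $n-1$). (c) Let $0\le i\le n-1$, and let $F$ be an $(i-1)$-face and $G$ an $(i+1)$-face of $\mathcal{K}$ with $F\le G$. Then the number of $i$-faces $H$ of $\mathcal{K}$ with $F\le H\le G$ is the index $|R_i:R_{-1}|$.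
   Context: Let $N=\{-1,0,\dots,n\}$. A generalized C-group is a group $\Gamma$ with subgroups $R_{-1},\dots,R_n$ generating $\Gamma$, such that $R_n=R_{-1}$ is a proper subgroup of $R_i$ for each $i=0,\dots,n-1$, and, with $\Gamma_I=\langle R_i:i\in I\rangle$ for nonempty $I\subseteq N$ and $\Gamma_\emptyset=R_{-1}$, $\Gamma_I\cap\Gamma_J=\Gamma_{I\cap J}$ for all $I,J\subseteq N$. It is a generalized string C-group if also $R_iR_j=R_jR_i$ for $-1\le i<j-1\le n-1$. Write $\Gamma_i=\Gamma_{N\setminus\{i\}}$, $\Gamma_i^-=\Gamma_{\{-1,\dots,i\}}$, $\Gamma_i^+=\Gamma_{\{i,\dots,n\}}$. The poset $\mathcal{K}(\Gamma)$ has as $i$-faces, $0\le i\le n-1$, the right cosets $\Gamma_i\varphi$, $\varphi\in\Gamma$, together with two distinct improper faces $\Gamma_{-1}$ (rank $-1$) and $\Gamma_n$ (rank $n$), each a copy of $\Gamma$ with $\Gamma_{-1}\varphi=\Gamma_{-1}$, $\Gamma_n\varphi=\Gamma_n$; the order is $\Gamma_i\varphi\le\Gamma_j\psi$ iff $i\le j$ and $\varphi\psi^{-1}\in\Gamma_{i+1}^+\Gamma_{j-1}^-$. It is a regular incidence complex of rank $n$ (a ranked poset with least and greatest faces, flags of $n+2$ elements, strongly connected, with at least two $i$-faces between incident $(i-1)$- and $(i+1)$-faces, whose automorphism group is flag-transitive). A section is $G/F=\{H: F\le H\le G\}$; a facet is an $(n-1)$-face $G$ viewed as $G/\Gamma_{-1}$,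 a vertex-figure is $\Gamma_n/F$ for a $0$-face $F$. Isomorphism means order-preserving bijection with order-preserving inverse. *)

theory Defs
  imports "HOL-Algebra.Algebra" "HOL-Library.Equipollence"
begin

section \<open>Generalized string C-groups\<close>

definition gen_subgp :: "('a, 'b) monoid_scheme \<Rightarrow> (int \<Rightarrow> 'a set) \<Rightarrow> int set \<Rightarrow> 'a set" where
  "gen_subgp G R I = (if I = {} then R (-1) else generate G (\<Union>i\<in>I. R i))"

locale generalized_C_group = group G for G (structure) +
  fixes R :: "int \<Rightarrow> 'a set" and n :: int
  assumes rank_nonneg: "0 \<le> n"
    and subgroup_R: "\<And>i. i \<in> {-1..n} \<Longrightarrow> subgroup (R i) G"
    and generate_R: "generate G (\<Union>i\<in>{-1..n}. R i) = carrier G"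
    and R_last: "R n = R (-1)"
    and R_proper: "\<And>i. i \<in> {0..n - 1} \<Longrightarrow> R (-1) \<subset> R i"
    and intersection: "\<And>I J. I \<subseteq> {-1..n} \<Longrightarrow> J \<subseteq> {-1..n} \<Longrightarrow>
           gen_subgp G R I \<inter> gen_subgp G R J = gen_subgp G R (I \<inter> J)"

locale generalized_string_C_group = generalized_C_group G R n
  for G (structure) and R :: "int \<Rightarrow> 'a set" and n :: int +
  assumes string: "\<And>i j. -1 \<le> i \<Longrightarrow> i < j - 1 \<Longrightarrow> j - 1 \<le> n - 1 \<Longrightarrow>
           R i <#> R j = R j <#> R i"


section \<open>Sections and isomorphisms of posets\<close>

definition poset_section :: "('f, 'm) gorder_scheme \<Rightarrow> 'f \<Rightarrow> 'f \<Rightarrow> ('f, 'm) gorder_scheme" where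
  "poset_section L x y = L\<lparr>carrier := \<lbrace>x..y\<rbrace>\<^bsub>L\<^esub>\<rparr>"

definition order_iso :: "('f \<Rightarrow> 'g) \<Rightarrow> ('f, 'm) gorder_scheme \<Rightarrow> ('g, 'k) gorder_scheme \<Rightarrow> bool" where
  "order_iso f P Q \<longleftrightarrow> bij_betw f (carrier P) (carrier Q) \<and>
     (\<forall>x\<in>carrier P. \<forall>y\<in>carrier P. x \<sqsubseteq>\<^bsub>P\<^esub> y \<longleftrightarrow> f x \<sqsubseteq>\<^bsub>Q\<^esub> f y)"

definition order_isomorphic :: "('f, 'm) gorder_scheme \<Rightarrow> ('g, 'k) gorder_scheme \<Rightarrow> bool" where
  "order_isomorphic P Q \<longleftrightarrow> (\<exists>f. order_iso f P Q)"


section \<open>Regular incidence complexes\<close>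

definition is_flag :: "('f, 'm) gorder_scheme \<Rightarrow> 'f set \<Rightarrow> bool" where
  "is_flag L \<Phi> \<longleftrightarrow> pred_on.maxchain (carrier L) (le L) \<Phi>"

definition proper_faces :: "('f, 'm) gorder_scheme \<Rightarrow> 'f \<Rightarrow> 'f \<Rightarrow> 'f set" where
  "proper_faces L x y = \<lbrace>x..y\<rbrace>\<^bsub>L\<^esub> - {x, y}"

definition section_connected :: "('f, 'm) gorder_scheme \<Rightarrow> 'f \<Rightarrow> 'f \<Rightarrow> bool" where
  "section_connected L x y \<longleftrightarrow>
     (\<forall>h\<in>proper_faces L x y. \<forall>h'\<in>proper_faces L x y.
        (h, h') \<in> {(u, v). u \<in> proper_faces L x y \<and> v \<in> proper_faces L x y \<and>
                            (u \<sqsubseteq>\<^bsub>L\<^esub> v \<or> v \<sqsubseteq>\<^bsub>L\<^esub> u)}\<^sup>*)"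

text \<open>Every face lies in a flag, and every flag has \<open>n + 2\<close> elements, so a strictly monotone
  \<open>rk\<close> with values in \<open>{-1..n}\<close> is uniquely determined by the order. The section from \<open>x\<close> to \<open>y\<close>
  has rank \<open>rk y - rk x - 1\<close>; sections of rank at most 1 are connected by convention.\<close>

locale incidence_complex = partial_order L for L (structure) +
  fixes rk :: "'a \<Rightarrow> int" and n :: int
  assumes least_face: "\<exists>x. least L x (carrier L)"
    and greatest_face: "\<exists>x. greatest L x (carrier L)"
    and rank_range: "\<And>x. x \<in> carrier L \<Longrightarrow> rk x \<in> {-1..n}"
    and rank_mono: "\<And>x y. x \<in> carrier L \<Longrightarrow> y \<in> carrier L \<Longrightarrow> x \<sqsubset> y \<Longrightarrow> rk x < rk y"
    and card_flag: "\<And>\<Phi>. is_flag L \<Phi> \<Longrightarrow> finite \<Phi> \<and> int (card \<Phi>) = n + 2"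
    and strongly_connected: "\<And>x y. x \<in> carrier L \<Longrightarrow> y \<in> carrier L \<Longrightarrow> x \<sqsubseteq> y \<Longrightarrow>
           2 \<le> rk y - rk x - 1 \<Longrightarrow> section_connected L x y"
    and two_between: "\<And>i x y. i \<in> {0..n - 1} \<Longrightarrow> x \<in> carrier L \<Longrightarrow> y \<in> carrier L \<Longrightarrow>
           rk x = i - 1 \<Longrightarrow> rk y = i + 1 \<Longrightarrow> x \<sqsubseteq> y \<Longrightarrow>
           \<exists>h h'. h \<noteq> h' \<and> h \<in> \<lbrace>x..y\<rbrace> \<and> h' \<in> \<lbrace>x..y\<rbrace> \<and> rk h = i \<and> rk h' = i"

locale regular_incidence_complex = incidence_complex L rk n
  for L (structure) and rk :: "'a \<Rightarrow> int" and n :: int +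
  assumes flag_transitive: "\<And>\<Phi> \<Psi>. is_flag L \<Phi> \<Longrightarrow> is_flag L \<Psi> \<Longrightarrow>
           \<exists>f. order_iso f L L \<and> f ` \<Phi> = \<Psi>"


section \<open>The complex of a generalized string C-group\<close>

definition face_subgp :: "('a, 'b) monoid_scheme \<Rightarrow> (int \<Rightarrow> 'a set) \<Rightarrow> int \<Rightarrow> int \<Rightarrow> 'a set" where
  "face_subgp G R n i = gen_subgp G R ({-1..n} - {i})"

text \<open>An \<open>i\<close>-face is a right coset tagged with its rank. Since \<open>R n = R (-1)\<close>, the subgroups
  \<open>face_subgp G R n (-1)\<close> and \<open>face_subgp G R n n\<close> are the whole group, so there is exactly one
  face of rank \<open>-1\<close> and one of rank \<open>n\<close>; the tags keep them (and any coinciding cosets of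
  different ranks) apart.\<close>

definition faces_of_rank ::
  "('a, 'b) monoid_scheme \<Rightarrow> (int \<Rightarrow> 'a set) \<Rightarrow> int \<Rightarrow> int \<Rightarrow> (int \<times> 'a set) set" where
  "faces_of_rank G R n i = {(i, face_subgp G R n i #>\<^bsub>G\<^esub> \<phi>) | \<phi>. \<phi> \<in> carrier G}"

definition least_face :: "('a, 'b) monoid_scheme \<Rightarrow> int \<times> 'a set" where
  "least_face G = (-1, carrier G)"

definition greatest_face :: "('a, 'b) monoid_scheme \<Rightarrow> int \<Rightarrow> int \<times> 'a set" where
  "greatest_face G n = (n, carrier G)"

text \<open>For a generalized string C-group the condition on \<open>\<phi>\<close> and \<open>\<psi>\<close> does not depend on the
  choice of coset representatives, because \<open>face_subgp G R n i\<close> is the product, in either order,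
  of the subgroups generated by the \<open>R k\<close> with \<open>k < i\<close> and with \<open>k > i\<close>.\<close>

definition coset_le :: "('a, 'b) monoid_scheme \<Rightarrow> (int \<Rightarrow> 'a set) \<Rightarrow> int \<Rightarrow>
    int \<times> 'a set \<Rightarrow> int \<times> 'a set \<Rightarrow> bool" where
  "coset_le G R n x y \<longleftrightarrow> fst x \<le> fst y \<and>
     (\<exists>\<phi>\<in>carrier G. \<exists>\<psi>\<in>carrier G.
        snd x = face_subgp G R n (fst x) #>\<^bsub>G\<^esub> \<phi> \<and>
        snd y = face_subgp G R n (fst y) #>\<^bsub>G\<^esub> \<psi> \<and>
        \<phi> \<otimes>\<^bsub>G\<^esub> inv\<^bsub>G\<^esub> \<psi> \<in>
          gen_subgp G R {fst x + 1..n} <#>\<^bsub>G\<^esub> gen_subgp G R {-1..fst y - 1})"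

definition coset_complex ::
  "('a, 'b) monoid_scheme \<Rightarrow> (int \<Rightarrow> 'a set) \<Rightarrow> int \<Rightarrow> (int \<times> 'a set) gorder" where
  "coset_complex G R n =
     \<lparr>carrier = (\<Union>i\<in>{-1..n}. faces_of_rank G R n i), eq = (=), le = coset_le G R n\<rparr>"

end

theory Submission
  imports Defs
begin

text \<open>Two faces are incident iff their cosets meet. By the string condition the subgroup of a
  face of rank \<open>j\<close> is the product of the subgroups generated above and below \<open>j\<close>; hence elements of
  two cosets through a common face of rank \<open>j\<close> can be replaced by one element that agrees with the
  first below \<open>j\<close> and with the second above \<open>j\<close>. So every chain of faces has a common element, the
  flags correspond to elements of the group, and right translations are transitive on them.
  The same argument shows that the faces between \<open>\<Gamma>\<^sub>i g\<close> and \<open>\<Gamma>\<^sub>j g\<close> are the cosets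
  \<open>\<Gamma>\<^sub>k v g\<close> with \<open>i \<le> k \<le> j\<close> and \<open>v\<close> in the subgroup \<open>\<Lambda>\<close> generated by the \<open>R l\<close>
  with \<open>i < l < j\<close>. By the intersection property \<open>\<Gamma>\<^sub>k v g \<mapsto> (\<Gamma>\<^sub>k \<inter> \<Lambda>) v\<close> is an isomorphism onto the
  complex of \<open>\<Lambda>\<close>.\<close>

section \<open>Orders and cosets\<close>

text \<open>Two maps with the same fibres on \<open>A\<close> have equipotent images: pick a
  preimage under \<open>a\<close> and apply \<open>b\<close>. This later turns a count of faces into
  a count of cosets of \<open>R (-1)\<close>.\<close>

lemma image_eqpoll_image:
  assumes "\<And>u v. u \<in> A \<Longrightarrow> v \<in> A \<Longrightarrow> a u = a v \<longleftrightarrow> b u = b v"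
  shows "a ` A \<approx> b ` A"
proof -
  have inv: "inv_into A a (a u) \<in> A \<and> b (inv_into A a (a u)) = b u" if "u \<in> A" for u
    using that assms by (metis f_inv_into_f imageI inv_into_into)
  have "bij_betw (\<lambda>x. b (inv_into A a x)) (a ` A) (b ` A)"
    unfolding bij_betw_def inj_on_def using inv assms by (auto simp: image_iff)
  then show ?thesis
    unfolding eqpoll_def by blast
qed

text \<open>Both posets are labelled by one set, where many labels may name the same element.
  Comparing the orders is enough, because antisymmetry forces the two labellings to identify the
  same labels.\<close>

lemma order_isomorphic_images:
  assumes P: "partial_order P" and Q: "partial_order Q"
    and cP: "carrier P = a ` A" and cQ: "carrier Q = b ` A"
    and le: "\<And>u v. u \<in> A \<Longrightarrow> v \<in> A \<Longrightarrow> a u \<sqsubseteq>\<^bsub>P\<^esub> a v \<longleftrightarrow> b u \<sqsubseteq>\<^bsub>Q\<^esub> b v"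
  shows "order_isomorphic P Q"
proof -
  interpret P: partial_order P by fact
  interpret Q: partial_order Q by fact
  have eq: "a u = a v \<longleftrightarrow> b u = b v" if "u \<in> A" "v \<in> A" for u v
    using le[OF that] le[OF that(2,1)] that cP cQ
    by (metis P.le_antisym P.le_refl Q.le_antisym Q.le_refl imageI)
  define f where "f x = b (inv_into A a x)" for x
  have f: "f (a u) = b u" if "u \<in> A" for u
    unfolding f_def using eq that by (metis f_inv_into_f imageI inv_into_into)
  have "order_iso f P Q"
    unfolding order_iso_def bij_betw_def inj_on_def cP cQ
    using eq le f by (auto simp: image_iff)
  then show ?thesis
    unfolding order_isomorphic_def by blast
qed

lemma partial_order_subset:
  assumes "partial_order L" "A \<subseteq> carrier L"
  shows "partial_order (L\<lparr>carrier := A\<rparr>)"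
proof -
  interpret partial_order L by fact
  show ?thesis
  proof
    show "(.=\<^bsub>L\<lparr>carrier := A\<rparr>\<^esub>) = (=)" by (simp add: eq_is_equal)
  next
    fix x y assume "x \<in> carrier (L\<lparr>carrier := A\<rparr>)" "y \<in> carrier (L\<lparr>carrier := A\<rparr>)"
      "x \<sqsubseteq>\<^bsub>L\<lparr>carrier := A\<rparr>\<^esub> y" "y \<sqsubseteq>\<^bsub>L\<lparr>carrier := A\<rparr>\<^esub> x"
    then show "x .=\<^bsub>L\<lparr>carrier := A\<rparr>\<^esub> y"
      using le_antisym[of x y] assms(2) by (auto simp: eq_is_equal)
  next
    fix x y z assume "x \<in> carrier (L\<lparr>carrier := A\<rparr>)" "y \<in> carrier (L\<lparr>carrier := A\<rparr>)"
      "z \<in> carrier (L\<lparr>carrier := A\<rparr>)"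
      "x \<sqsubseteq>\<^bsub>L\<lparr>carrier := A\<rparr>\<^esub> y" "y \<sqsubseteq>\<^bsub>L\<lparr>carrier := A\<rparr>\<^esub> z"
    then show "x \<sqsubseteq>\<^bsub>L\<lparr>carrier := A\<rparr>\<^esub> z"
      using le_trans[of x y z] assms(2) by auto
  qed (use assms(2) in \<open>auto simp: eq_is_equal\<close>)
qed

context group
begin

lemma r_coset_eq_iff:
  assumes "subgroup H G" "x \<in> carrier G" "y \<in> carrier G"
  shows "H #> x = H #> y \<longleftrightarrow> x \<otimes> inv y \<in> H"
proof
  assume "H #> x = H #> y"
  then have "x \<in> H #> y"
    using rcos_self[OF assms(2,1)] by simp
  then obtain h where "h \<in> H" "x = h \<otimes> y"
    unfolding r_coset_def by auto
  then show "x \<otimes> inv y \<in> H"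
    using assms by (simp add: m_assoc subgroup.mem_carrier)
next
  assume h: "x \<otimes> inv y \<in> H"
  have "x = (x \<otimes> inv y) \<otimes> y"
    using assms by (simp add: m_assoc)
  then have "x \<in> H #> y"
    using h unfolding r_coset_def by auto
  then show "H #> x = H #> y"
    using repr_independence[OF _ assms(3,1)] by simp
qed

lemma mult_inv_mult_cancel:
  assumes "a \<in> carrier G" "b \<in> carrier G" "c \<in> carrier G"
  shows "(a \<otimes> c) \<otimes> inv (b \<otimes> c) = a \<otimes> inv b"
proof -
  have "c \<otimes> (inv c \<otimes> inv b) = inv b"
    using assms m_assoc[of c "inv c" "inv b"] by simp
  then show ?thesis
    using assms by (simp add: inv_mult_group m_assoc)
qed

end

section \<open>Subgroups generated by distinguished subgroups\<close>

context generalized_C_group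
begin

text \<open>Only the indices \<open>0, \<dots>, n - 1\<close> matter, since \<open>R n = R (-1)\<close> is contained in every \<open>R i\<close>.
  Unlike \<^const>\<open>gen_subgp\<close> this is monotone in \<open>I\<close> and meaningful for every \<open>I\<close>, so that no
  index set has to be cut down to \<open>{-1..n}\<close>.\<close>

definition std :: "int set \<Rightarrow> 'a set" where
  "std I = generate G (R (-1) \<union> (\<Union>i\<in>I \<inter> {0..n - 1}. R i))"

lemma base_subgroup: "subgroup (R (-1)) G"
  using subgroup_R rank_nonneg by simp

lemma base_subset_R: "i \<in> {-1..n} \<Longrightarrow> R (-1) \<subseteq> R i"
  using R_proper[of i] R_last by (cases "i = -1 \<or> i = n") auto

lemma generators_in_carrier: "R (-1) \<union> (\<Union>i\<in>I \<inter> {0..n - 1}. R i) \<subseteq> carrier G"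
  by (intro Un_least UN_least subgroup.subset base_subgroup subgroup_R) auto

lemma std_subgroup: "subgroup (std I) G"
  unfolding std_def by (rule generate_is_subgroup[OF generators_in_carrier])

lemma std_carrier: "x \<in> std I \<Longrightarrow> x \<in> carrier G"
  using std_subgroup subgroup.mem_carrier by fast

lemma std_mono: "I \<subseteq> J \<Longrightarrow> std I \<subseteq> std J"
  unfolding std_def by (rule mono_generate) auto

lemma R_subset_std: "i \<in> I \<Longrightarrow> i \<in> {0..n - 1} \<Longrightarrow> R i \<subseteq> std I"
  unfolding std_def by (auto intro: generate.incl)

lemma std_cong: "I \<inter> {0..n - 1} = J \<inter> {0..n - 1} \<Longrightarrow> std I = std J"
  by (simp add: std_def)

text \<open>\<open>R (-1)\<close> and \<open>R n\<close> contribute only the base subgroup, which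
  every other \<open>R i\<close> contains already. The convention for the empty index set fits the
  same formula.\<close>

lemma gen_subgp_eq_std:
  assumes "I \<subseteq> {-1..n}"
  shows "gen_subgp G R I = std I"
proof (cases "I = {}")
  case True
  then show ?thesis
    using generateI[OF base_subgroup] generate_incl[OF subgroup.subset[OF base_subgroup]]
      generate_subgroup_incl[OF order_refl base_subgroup] generate.incl[of _ "R (-1)"]
    by (auto simp: gen_subgp_def std_def)
next
  case False
  have sub: "R k \<subseteq> R (-1) \<union> (\<Union>i\<in>I \<inter> {0..n - 1}. R i)" if "k \<in> I" for k
    using that assms R_last by (cases "k = -1 \<or> k = n") auto
  have "(\<Union>i\<in>I. R i) = R (-1) \<union> (\<Union>i\<in>I \<inter> {0..n - 1}. R i)"
    using False assms base_subset_R sub by blast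
  then show ?thesis
    using False by (simp add: gen_subgp_def std_def)
qed

lemma std_empty: "I \<inter> {0..n - 1} = {} \<Longrightarrow> std I = R (-1)"
  using gen_subgp_eq_std[of "{}"] std_cong[of I "{}"] by (simp add: gen_subgp_def)

lemma std_all:
  assumes "{0..n - 1} \<subseteq> I"
  shows "std I = carrier G"
proof -
  have "std I = gen_subgp G R {-1..n}"
    unfolding gen_subgp_eq_std[OF order_refl] using assms by (intro std_cong) auto
  then show ?thesis
    using generate_R rank_nonneg by (simp add: gen_subgp_def)
qed

lemma std_singleton:
  assumes "i \<in> {0..n - 1}"
  shows "std {i} = R i"
proof -
  have "std {i} = generate G (R i)"
    using gen_subgp_eq_std[of "{i}"] assms by (simp add: gen_subgp_def)
  then show ?thesis
    using subgroup_R[of i] assms generate_subgroup_incl[of "R i" "R i"] generate.incl[of _ "R i"]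
    by auto
qed

text \<open>The intersection property is assumed only for index sets inside \<open>{-1..n}\<close>.
  Since \<open>std\<close> depends only on the indices in \<open>{0..n - 1}\<close>, cutting both
  sets down to these removes the restriction.\<close>

lemma std_Int: "std I \<inter> std J = std (I \<inter> J)"
proof -
  have std: "std K = gen_subgp G R (K \<inter> {0..n - 1})" for K
    using gen_subgp_eq_std[of "K \<inter> {0..n - 1}"] std_cong[of K "K \<inter> {0..n - 1}"] by fastforce
  have "I \<inter> {0..n - 1} \<inter> (J \<inter> {0..n - 1}) = I \<inter> J \<inter> {0..n - 1}"
    by blast
  moreover have "I \<inter> {0..n - 1} \<subseteq> {-1..n}" "J \<inter> {0..n - 1} \<subseteq> {-1..n}"
    by auto
  ultimately show ?thesis
    using intersection[of "I \<inter> {0..n - 1}" "J \<inter> {0..n - 1}"]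
    unfolding std[of I] std[of J] std[of "I \<inter> J"] by simp
qed

lemma std_mult: "x \<in> std I \<Longrightarrow> y \<in> std I \<Longrightarrow> x \<otimes> y \<in> std I"
  by (rule subgroup.m_closed[OF std_subgroup])

lemma std_inv: "x \<in> std I \<Longrightarrow> inv x \<in> std I"
  by (rule subgroup.m_inv_closed[OF std_subgroup])

lemma base_subset_std: "R (-1) \<subseteq> std I"
  using std_empty[of "{}"] std_mono[of "{}" I] by simp

text \<open>The generators form a union of subgroups, so the inverse of a generator is again a
  generator and needs no case of its own.\<close>

lemma std_induct [consumes 1, case_names base R mult]:
  assumes "x \<in> std I"
    and "\<And>x. x \<in> R (-1) \<Longrightarrow> P x"
    and "\<And>x i. i \<in> I \<Longrightarrow> i \<in> {0..n - 1} \<Longrightarrow> x \<in> R i \<Longrightarrow> P x"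
    and "\<And>x y. x \<in> std I \<Longrightarrow> y \<in> std I \<Longrightarrow> P x \<Longrightarrow> P y \<Longrightarrow> P (x \<otimes> y)"
  shows "P x"
  using assms(1) unfolding std_def
proof (induction rule: generate.induct)
  case one
  show ?case using assms(2) base_subgroup by (simp add: subgroup.one_closed)
next
  case (incl h)
  then show ?case using assms(2,3) by blast
next
  case (inv h)
  then consider "h \<in> R (-1)" | i where "i \<in> I" "i \<in> {0..n - 1}" "h \<in> R i" by blast
  then show ?case
  proof cases
    case 1
    then show ?thesis using assms(2) base_subgroup by (simp add: subgroup.m_inv_closed)
  next
    case 2
    then have "subgroup (R i) G" using subgroup_R by simp
    then show ?thesis using assms(3) 2 by (simp add: subgroup.m_inv_closed)
  qed
next
  case (eng h1 h2)
  then show ?case using assms(4) by (simp add: std_def)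
qed

end

section \<open>Factorizations from the string condition\<close>

context generalized_string_C_group
begin

lemma R_commute:
  assumes "i \<in> {0..n - 1}" "j \<in> {0..n - 1}" "\<bar>i - j\<bar> \<ge> 2"
  shows "R i <#> R j = R j <#> R i"
  using string[of i j] string[of j i] assms by (cases "i < j") auto

text \<open>The element \<open>r\<close> is moved to the right through \<open>a\<close> one factor
  at a time. It may change on the way, hence the generalization over \<open>r\<close>. A factor from
  \<open>R (-1)\<close> is not passed but absorbed into \<open>R j\<close>.\<close>

lemma R_std_swap:
  assumes j: "j \<in> {0..n - 1}" and far: "\<And>i. i \<in> I \<Longrightarrow> \<bar>i - j\<bar> \<ge> 2"
    and a: "a \<in> std I" and r: "r \<in> R j"
  shows "r \<otimes> a \<in> std I <#> R j"
  using a r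
proof (induction arbitrary: r rule: std_induct)
  case (base x)
  have s: "subgroup (R j) G" using subgroup_R j by simp
  have "r \<otimes> x \<in> R j"
    using base s base_subset_R[of j] j by (auto intro: subgroup.m_closed)
  moreover have "r \<otimes> x = \<one> \<otimes> (r \<otimes> x)"
    using calculation s subgroup.mem_carrier by fastforce
  ultimately show ?case
    unfolding set_mult_def using subgroup.one_closed[OF std_subgroup] by blast
next
  case (R x i)
  then have "r \<otimes> x \<in> R i <#> R j"
    using R_commute[of i j] far j unfolding set_mult_def by blast
  then show ?case
    using R_subset_std[OF R(1,2)] unfolding set_mult_def by blast
next
  case (mult x y)
  have s: "subgroup (R j) G" using subgroup_R j by simp
  obtain x' r' where 1: "x' \<in> std I" "r' \<in> R j" "r \<otimes> x = x' \<otimes> r'"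
    using mult.IH(1)[OF mult.prems] unfolding set_mult_def by blast
  obtain y' r'' where 2: "y' \<in> std I" "r'' \<in> R j" "r' \<otimes> y = y' \<otimes> r''"
    using mult.IH(2)[OF 1(2)] unfolding set_mult_def by blast
  note c = std_carrier[OF 1(1)] std_carrier[OF 2(1)] std_carrier[OF mult.hyps(1)]
    std_carrier[OF mult.hyps(2)] subgroup.mem_carrier[OF s 1(2)]
    subgroup.mem_carrier[OF s 2(2)] subgroup.mem_carrier[OF s mult.prems]
  have "r \<otimes> (x \<otimes> y) = (r \<otimes> x) \<otimes> y" using c by (simp add: m_assoc)
  also have "\<dots> = x' \<otimes> (r' \<otimes> y)" using c 1 by (simp add: m_assoc)
  also have "\<dots> = (x' \<otimes> y') \<otimes> r''" using c 2 by (simp add: m_assoc)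
  finally show ?case
    using std_mult[OF 1(1) 2(1)] 2(2) unfolding set_mult_def by blast
qed

text \<open>The product set is stable under left multiplication by every generator: one from
  \<open>I\<close> is absorbed by the left factor, one from \<open>J\<close> is first carried past
  it by \<open>R_std_swap\<close>. Stability, unlike membership, passes directly to products;
  applied to the unit it gives the claim.\<close>

lemma std_factor:
  assumes far: "\<And>i j. i \<in> I \<Longrightarrow> j \<in> J \<Longrightarrow> \<bar>i - j\<bar> \<ge> 2" and u: "u \<in> std (I \<union> J)"
  shows "u \<in> std I <#> std J"
proof -
  have "\<forall>x \<in> std I <#> std J. u \<otimes> x \<in> std I <#> std J"
    using u
  proof (induction rule: std_induct)
    case (base r)
    then have "r \<in> std I" using base_subset_std by blast
    then show ?case
      unfolding set_mult_def
      by (auto simp: m_assoc[symmetric] std_carrier) (metis std_mult)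
  next
    case (R r k)
    show ?case
    proof (cases "k \<in> I")
      case True
      then have "r \<in> std I" using R_subset_std[OF True] R by blast
      then show ?thesis
        unfolding set_mult_def
        by (auto simp: m_assoc[symmetric] std_carrier) (metis std_mult)
    next
      case False
      then have k: "k \<in> J" using R by simp
      have s: "subgroup (R k) G" using subgroup_R R by simp
      show ?thesis
      proof
        fix x assume "x \<in> std I <#> std J"
        then obtain a b where ab: "a \<in> std I" "b \<in> std J" "x = a \<otimes> b"
          unfolding set_mult_def by blast
        have "r \<otimes> a \<in> std I <#> R k"
          using R_std_swap[of k I a r] R ab far k by blast
        then obtain a' r' where 1: "a' \<in> std I" "r' \<in> R k" "r \<otimes> a = a' \<otimes> r'"
          unfolding set_mult_def by blast
        have r': "r' \<in> std J" using R_subset_std[OF k] R 1 by blast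
        have "r \<otimes> x = (r \<otimes> a) \<otimes> b"
          using ab std_carrier subgroup.mem_carrier[OF s R(3)] by (simp add: m_assoc)
        also have "\<dots> = a' \<otimes> (r' \<otimes> b)"
          using 1 r' ab std_carrier by (simp add: m_assoc)
        finally show "r \<otimes> x \<in> std I <#> std J"
          using 1 std_mult[OF r' ab(2)] unfolding set_mult_def by blast
      qed
    qed
  next
    case (mult x y)
    show ?case
    proof
      fix z assume z: "z \<in> std I <#> std J"
      then have "z \<in> carrier G" unfolding set_mult_def by (auto simp: std_carrier)
      then have "x \<otimes> y \<otimes> z = x \<otimes> (y \<otimes> z)"
        using mult.hyps std_carrier by (simp add: m_assoc)
      then show "x \<otimes> y \<otimes> z \<in> std I <#> std J" using mult.IH z by simp
    qed
  qed
  moreover have "\<one> \<in> std I <#> std J"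
    unfolding set_mult_def using subgroup.one_closed[OF std_subgroup] r_one[OF one_closed]
    by (metis (mono_tags, lifting) UN_I singletonI)
  ultimately show ?thesis using u std_carrier by (metis r_one)
qed

section \<open>Faces and incidence\<close>

text \<open>The complement is taken in all integers, so that no rank bounds are needed. For ranks in
  \<open>{-1..n}\<close> the subgroup is the one used in the complex, by
  \<open>face_subgp_eq_std\<close>.\<close>

definition face :: "int \<Rightarrow> 'a \<Rightarrow> int \<times> 'a set" where
  "face i x = (i, std (- {i}) #> x)"

abbreviation K :: "(int \<times> 'a set) gorder" where
  "K \<equiv> coset_complex G R n"

lemma fst_face [simp]: "fst (face i x) = i"
  by (simp add: face_def)

lemma face_eq_iff:
  assumes "x \<in> carrier G" "y \<in> carrier G"
  shows "face i x = face j y \<longleftrightarrow> i = j \<and> x \<otimes> inv y \<in> std (- {i})"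
  using r_coset_eq_iff[OF std_subgroup assms, of "- {i}"] by (auto simp: face_def)

lemma face_mult_left:
  assumes "a \<in> std (- {i})" "x \<in> carrier G"
  shows "face i (a \<otimes> x) = face i x"
  using assms std_carrier[OF assms(1)] by (simp add: face_eq_iff m_assoc)

lemma face_mult_right:
  assumes "x \<in> carrier G" "y \<in> carrier G" "g \<in> carrier G"
  shows "face i (x \<otimes> g) = face j (y \<otimes> g) \<longleftrightarrow> face i x = face j y"
  using assms by (simp add: face_eq_iff mult_inv_mult_cancel)

lemma face_improper:
  assumes "i \<notin> {0..n - 1}" "x \<in> carrier G" "y \<in> carrier G"
  shows "face i x = face i y"
  using assms std_all[of "- {i}"] by (auto simp: face_eq_iff)

lemma face_subgp_eq_std:
  assumes "i \<in> {-1..n}"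
  shows "face_subgp G R n i = std (- {i})"
  unfolding face_subgp_def
  by (subst gen_subgp_eq_std) (use assms in \<open>auto intro!: std_cong\<close>)

lemma faces_of_rank_eq: "i \<in> {-1..n} \<Longrightarrow> faces_of_rank G R n i = face i ` carrier G"
  unfolding faces_of_rank_def face_def by (auto simp: face_subgp_eq_std)

lemma carrier_complex: "carrier K = (\<Union>i\<in>{-1..n}. face i ` carrier G)"
  by (simp add: coset_complex_def faces_of_rank_eq)

lemma face_in_carrier: "i \<in> {-1..n} \<Longrightarrow> x \<in> carrier G \<Longrightarrow> face i x \<in> carrier K"
  by (auto simp: carrier_complex)

lemma carrier_faceE:
  assumes "F \<in> carrier K"
  obtains i x where "i \<in> {-1..n}" "x \<in> carrier G" "F = face i x"
  using assms by (auto simp: carrier_complex)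

text \<open>The representatives in \<^const>\<open>coset_le\<close> are existentially quantified, so both can be taken
  to be the common element \<open>z\<close>.\<close>

lemma coset_le_face_iff:
  assumes i: "i \<in> {-1..n}" and j: "j \<in> {-1..n}" and x: "x \<in> carrier G" and y: "y \<in> carrier G"
  shows "face i x \<sqsubseteq>\<^bsub>K\<^esub> face j y \<longleftrightarrow>
    i \<le> j \<and> (\<exists>z\<in>carrier G. face i z = face i x \<and> face j z = face j y)"
proof -
  have up: "gen_subgp G R {i + 1..n} = std {i<..}"
    using i by (subst gen_subgp_eq_std) (auto intro!: std_cong)
  have down: "gen_subgp G R {-1..j - 1} = std {..<j}"
    using j by (subst gen_subgp_eq_std) (auto intro!: std_cong)
  have "face i x \<sqsubseteq>\<^bsub>K\<^esub> face j y \<longleftrightarrow> i \<le> j \<and>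
     (\<exists>\<phi>\<in>carrier G. \<exists>\<psi>\<in>carrier G. face i x = face i \<phi> \<and> face j y = face j \<psi> \<and>
        \<phi> \<otimes> inv \<psi> \<in> std {i<..} <#> std {..<j})"
    unfolding face_def
    by (simp add: coset_complex_def coset_le_def up down face_subgp_eq_std[OF i] face_subgp_eq_std[OF j])
  also have "\<dots> \<longleftrightarrow> i \<le> j \<and> (\<exists>z\<in>carrier G. face i z = face i x \<and> face j z = face j y)"
  proof (intro conj_cong refl iffI)
    assume "i \<le> j" "\<exists>\<phi>\<in>carrier G. \<exists>\<psi>\<in>carrier G. face i x = face i \<phi> \<and> face j y = face j \<psi> \<and>
        \<phi> \<otimes> inv \<psi> \<in> std {i<..} <#> std {..<j}"
    then obtain \<phi> \<psi> a b where *: "\<phi> \<in> carrier G" "\<psi> \<in> carrier G" "face i x = face i \<phi>"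
      "face j y = face j \<psi>" "\<phi> \<otimes> inv \<psi> = a \<otimes> b" "a \<in> std {i<..}" "b \<in> std {..<j}"
      unfolding set_mult_def by blast
    have ab: "a \<in> std (- {i})" "b \<in> std (- {j})"
      using *(6,7) std_mono[of "{i<..}" "- {i}"] std_mono[of "{..<j}" "- {j}"] by auto
    note c = ab[THEN std_carrier] *(1,2)
    \<comment> \<open>The common element is \<open>b \<otimes> \<psi>\<close>: it differs from
      \<open>\<psi>\<close> by \<open>b\<close>, which is generated below \<open>j\<close>, and from
      \<open>\<phi>\<close> by \<open>a\<close>, which is generated above \<open>i\<close>.\<close>
    have "\<phi> = a \<otimes> (b \<otimes> \<psi>)"
      using c *(5) by (metis inv_closed inv_solve_right m_assoc m_closed)
    then have "face i (b \<otimes> \<psi>) = face i x" "face j (b \<otimes> \<psi>) = face j y"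
      using face_mult_left ab c * by (metis m_closed)+
    then show "\<exists>z\<in>carrier G. face i z = face i x \<and> face j z = face j y"
      using c by blast
  next
    assume "i \<le> j" "\<exists>z\<in>carrier G. face i z = face i x \<and> face j z = face j y"
    moreover have "\<one> \<in> std {i<..} <#> std {..<j}"
      unfolding set_mult_def using subgroup.one_closed[OF std_subgroup] r_one[OF one_closed]
      by (metis (mono_tags, lifting) UN_I singletonI)
    ultimately show "\<exists>\<phi>\<in>carrier G. \<exists>\<psi>\<in>carrier G. face i x = face i \<phi> \<and> face j y = face j \<psi> \<and>
        \<phi> \<otimes> inv \<psi> \<in> std {i<..} <#> std {..<j}"
      by (metis r_inv)
  qed
  finally show ?thesis .
qed

text \<open>The quotient \<open>x \<otimes> inv y\<close> lies in the subgroup of a face of rank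
  \<open>j\<close> and so factors as \<open>a \<otimes> b\<close> with \<open>a\<close> generated
  above \<open>j\<close> and \<open>b\<close> below. Then \<open>b \<otimes> y\<close>, which equals
  \<open>inv a \<otimes> x\<close>, agrees with \<open>x\<close> up to rank \<open>j\<close> and
  with \<open>y\<close> from rank \<open>j\<close> on.\<close>

lemma glue:
  assumes x: "x \<in> carrier G" and y: "y \<in> carrier G" and eq: "face j x = face j y"
  obtains z where "z \<in> carrier G" "\<And>i. i \<le> j \<Longrightarrow> face i z = face i x"
    "\<And>k. k \<ge> j \<Longrightarrow> face k z = face k y"
proof -
  have "{j<..} \<union> {..<j} = - {j}" by auto
  then have "x \<otimes> inv y \<in> std {j<..} <#> std {..<j}"
    using eq x y by (intro std_factor) (auto simp: face_eq_iff)
  then obtain a b where ab: "a \<in> std {j<..}" "b \<in> std {..<j}" "x \<otimes> inv y = a \<otimes> b"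
    unfolding set_mult_def by blast
  note c = ab(1,2)[THEN std_carrier] x y
  have x_eq: "x = a \<otimes> (b \<otimes> y)"
    using c ab(3) by (metis inv_closed inv_solve_right m_assoc m_closed)
  show ?thesis
  proof
    show "b \<otimes> y \<in> carrier G" using c by simp
    show "face i (b \<otimes> y) = face i x" if "i \<le> j" for i
    proof -
      have "a \<in> std (- {i})" using ab(1) std_mono[of "{j<..}" "- {i}"] that by auto
      then show ?thesis using x_eq face_mult_left[of a i "b \<otimes> y"] c by simp
    qed
    show "face k (b \<otimes> y) = face k y" if "k \<ge> j" for k
    proof -
      have "b \<in> std (- {k})" using ab(2) std_mono[of "{..<j}" "- {k}"] that by auto
      then show ?thesis using face_mult_left c by simp
    qed
  qed
qed

lemma section_representative:
  assumes g: "g \<in> carrier G" and z: "z \<in> carrier G"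
    and eqi: "face i z = face i g" and eqj: "face j z = face j g"
  obtains v where "v \<in> std {i<..<j}" "\<And>k. k \<in> {i..j} \<Longrightarrow> face k z = face k (v \<otimes> g)"
proof -
  have "z \<otimes> inv g \<in> std (- {i} \<inter> - {j})"
    using eqi eqj g z unfolding std_Int[symmetric] by (simp add: face_eq_iff)
  moreover have "std (- {i} \<inter> - {j}) \<subseteq> std (- {i..j} \<union> {i<..<j})"
    by (rule std_mono) auto
  ultimately have "z \<otimes> inv g \<in> std (- {i..j}) <#> std {i<..<j}"
    by (intro std_factor) auto
  then obtain a b where ab: "a \<in> std (- {i..j})" "b \<in> std {i<..<j}" "z \<otimes> inv g = a \<otimes> b"
    unfolding set_mult_def by blast
  note c = ab(1,2)[THEN std_carrier] g z
  have z_eq: "z = a \<otimes> (b \<otimes> g)"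
    using c ab(3) by (metis inv_closed inv_solve_right m_assoc m_closed)
  have "face k z = face k (b \<otimes> g)" if "k \<in> {i..j}" for k
  proof -
    have "a \<in> std (- {k})" using ab(1) std_mono[of "- {i..j}" "- {k}"] that by auto
    then show ?thesis using z_eq face_mult_left c by simp
  qed
  then show ?thesis using that ab(2) by blast
qed

lemma coset_le_faceE:
  assumes "F \<in> carrier K" "H \<in> carrier K" "F \<sqsubseteq>\<^bsub>K\<^esub> H"
  obtains z where "z \<in> carrier G" "F = face (fst F) z" "H = face (fst H) z" "fst F \<le> fst H"
  using assms by (auto elim!: carrier_faceE simp: coset_le_face_iff)

lemma coset_le_faceI:
  "i \<in> {-1..n} \<Longrightarrow> j \<in> {-1..n} \<Longrightarrow> i \<le> j \<Longrightarrow> x \<in> carrier G \<Longrightarrow> face i x \<sqsubseteq>\<^bsub>K\<^esub> face j x"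
  by (auto simp: coset_le_face_iff)

lemma fst_carrier: "F \<in> carrier K \<Longrightarrow> fst F \<in> {-1..n}"
  by (auto elim: carrier_faceE)

text \<open>Incident faces share a group element, so equal ranks give equal cosets. Asking only for
  a rank inequality in place of the reverse incidence makes this serve also for strict monotonicity
  of the rank.\<close>

lemma complex_antisym:
  assumes "F \<in> carrier K" "H \<in> carrier K" "F \<sqsubseteq>\<^bsub>K\<^esub> H" "fst H \<le> fst F"
  shows "F = H"
  using assms by (metis coset_le_faceE order_antisym)

lemma complex_refl: "F \<in> carrier K \<Longrightarrow> F \<sqsubseteq>\<^bsub>K\<^esub> F"
  by (auto elim!: carrier_faceE intro: coset_le_faceI)

lemma complex_trans:
  assumes F: "F \<in> carrier K" and H: "H \<in> carrier K" and L: "L \<in> carrier K"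
    and FH: "F \<sqsubseteq>\<^bsub>K\<^esub> H" and HL: "H \<sqsubseteq>\<^bsub>K\<^esub> L"
  shows "F \<sqsubseteq>\<^bsub>K\<^esub> L"
proof -
  obtain x where x: "x \<in> carrier G" "F = face (fst F) x" "H = face (fst H) x" "fst F \<le> fst H"
    using F H FH by (rule coset_le_faceE)
  obtain y where y: "y \<in> carrier G" "H = face (fst H) y" "L = face (fst L) y" "fst H \<le> fst L"
    using H L HL by (rule coset_le_faceE)
  \<comment> \<open>Both representatives give the middle face \<open>H\<close>, so they can be glued
    at its rank.\<close>
  obtain z where z: "z \<in> carrier G" "\<And>i. i \<le> fst H \<Longrightarrow> face i z = face i x"
      "\<And>k. k \<ge> fst H \<Longrightarrow> face k z = face k y"
    using glue[OF x(1) y(1)] x(3) y(2) by metis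
  have "F = face (fst F) z" "L = face (fst L) z"
    using x y z by metis+
  moreover have "fst F \<le> fst L" using x y by simp
  ultimately show ?thesis
    using coset_le_faceI[OF fst_carrier[OF F] fst_carrier[OF L]] z(1) by metis
qed

lemma eq_complex: "x .=\<^bsub>K\<^esub> y \<longleftrightarrow> x = y"
  by (simp add: coset_complex_def)

lemma complex_partial_order: "partial_order K"
proof
  fix x y assume "x \<in> carrier K" "y \<in> carrier K" "x \<sqsubseteq>\<^bsub>K\<^esub> y" "y \<sqsubseteq>\<^bsub>K\<^esub> x"
  then show "x .=\<^bsub>K\<^esub> y"
    unfolding eq_complex by (metis complex_antisym coset_le_faceE)
next
  fix x y z assume "x \<in> carrier K" "y \<in> carrier K" "z \<in> carrier K" "x \<sqsubseteq>\<^bsub>K\<^esub> y" "y \<sqsubseteq>\<^bsub>K\<^esub> z"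
  then show "x \<sqsubseteq>\<^bsub>K\<^esub> z" by (rule complex_trans)
next
  show "(.=\<^bsub>K\<^esub>) = (=)" by (intro ext eq_complex)
qed (simp_all add: eq_complex complex_refl)

text \<open>A face \<open>E\<close> of the section shares one element with the lower end and one
  with the upper end. Gluing these at the rank of \<open>E\<close> gives an element through all
  three faces, which \<open>section_representative\<close> replaces by some
  \<open>v \<otimes> g\<close>. Conversely, such a \<open>v\<close> fixes both ends.\<close>

lemma section_carrier:
  assumes i: "i \<in> {-1..n}" and j: "j \<in> {-1..n}" and g: "g \<in> carrier G"
  shows "\<lbrace>face i g..face j g\<rbrace>\<^bsub>K\<^esub> = (\<lambda>(k, v). face k (v \<otimes> g)) ` ({i..j} \<times> std {i<..<j})"
proof (intro equalityI subsetI)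
  fix E assume "E \<in> \<lbrace>face i g..face j g\<rbrace>\<^bsub>K\<^esub>"
  then have E: "E \<in> carrier K" "face i g \<sqsubseteq>\<^bsub>K\<^esub> E" "E \<sqsubseteq>\<^bsub>K\<^esub> face j g"
    by (auto simp: at_least_at_most_def)
  obtain x where x: "x \<in> carrier G" "face i g = face i x" "E = face (fst E) x" "i \<le> fst E"
    using coset_le_faceE[OF face_in_carrier[OF i g] E(1,2)] by (metis fst_face)
  obtain y where y: "y \<in> carrier G" "E = face (fst E) y" "face j g = face j y" "fst E \<le> j"
    using coset_le_faceE[OF E(1) face_in_carrier[OF j g] E(3)] by (metis fst_face)
  obtain z where z: "z \<in> carrier G" "\<And>l. l \<le> fst E \<Longrightarrow> face l z = face l x"
      "\<And>k. k \<ge> fst E \<Longrightarrow> face k z = face k y"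
    using glue[OF x(1) y(1)] x(3) y(2) by metis
  obtain v where v: "v \<in> std {i<..<j}" "\<And>k. k \<in> {i..j} \<Longrightarrow> face k z = face k (v \<otimes> g)"
    using section_representative[OF g z(1)] x y z by metis
  have "E = face (fst E) (v \<otimes> g)"
    using v(2)[of "fst E"] z(2)[of "fst E"] x(3,4) y(4) by simp
  then show "E \<in> (\<lambda>(k, v). face k (v \<otimes> g)) ` ({i..j} \<times> std {i<..<j})"
    using v(1) x(4) y(4) by (intro image_eqI[of _ _ "(fst E, v)"]) auto
next
  fix E assume "E \<in> (\<lambda>(k, v). face k (v \<otimes> g)) ` ({i..j} \<times> std {i<..<j})"
  then obtain k v where E: "E = face k (v \<otimes> g)" "k \<in> {i..j}" "v \<in> std {i<..<j}" by auto
  have v: "v \<in> carrier G" "v \<in> std (- {i})" "v \<in> std (- {j})"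
    using E(3) std_carrier std_mono[of "{i<..<j}" "- {i}"] std_mono[of "{i<..<j}" "- {j}"] by auto
  have "face i g = face i (v \<otimes> g)" "face j g = face j (v \<otimes> g)"
    using v g by (simp_all add: face_mult_left)
  then show "E \<in> \<lbrace>face i g..face j g\<rbrace>\<^bsub>K\<^esub>"
    using E v g i j by (simp add: at_least_at_most_def face_in_carrier coset_le_faceI)
qed

section \<open>Flags, automorphisms and connectedness\<close>

text \<open>Faces are added in order of rank. The new face is then incident with the top face of the
  chain so far, and gluing at the rank of that top face keeps all the earlier faces.\<close>

lemma chain_common_element:
  assumes "finite c" "c \<subseteq> carrier K" "\<And>F H. F \<in> c \<Longrightarrow> H \<in> c \<Longrightarrow> F \<sqsubseteq>\<^bsub>K\<^esub> H \<or> H \<sqsubseteq>\<^bsub>K\<^esub> F"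
  shows "\<exists>g\<in>carrier G. \<forall>F\<in>c. F = face (fst F) g"
  using assms
proof (induction c rule: finite_ranking_induct[where f = fst])
  case empty
  show ?case by auto
next
  case (insert F c)
  then obtain g where g: "g \<in> carrier G" "\<And>H. H \<in> c \<Longrightarrow> H = face (fst H) g"
    by (metis insert_subset insertCI)
  show ?case
  proof (cases "c = {}")
    case True
    then show ?thesis using insert.prems(1) by simp (metis carrier_faceE fst_face)
  next
    case False
    then have "Max (fst ` c) \<in> fst ` c" using insert.hyps(1) by simp
    then obtain T where T: "T \<in> c" "fst T = Max (fst ` c)" by fastforce
    then have top: "fst H \<le> fst T" if "H \<in> c" for H using that insert.hyps(1) by simp
    have "T \<in> carrier K" "F \<in> carrier K" using insert.prems(1) T(1) by auto
    moreover have "T \<sqsubseteq>\<^bsub>K\<^esub> F"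
      using insert.prems(2)[of T F] insert.hyps(2)[OF T(1)] T(1) calculation complex_antisym complex_refl
      by blast
    ultimately obtain y where y: "y \<in> carrier G" "T = face (fst T) y" "F = face (fst F) y" "fst T \<le> fst F"
      by (rule coset_le_faceE)
    obtain z where z: "z \<in> carrier G" "\<And>i. i \<le> fst T \<Longrightarrow> face i z = face i g"
      "\<And>k. k \<ge> fst T \<Longrightarrow> face k z = face k y"
      using glue[OF g(1) y(1)] g(2)[OF T(1)] y(2) by metis
    have "H = face (fst H) z" if "H \<in> insert F c" for H
      using that g(2) top z(2,3) y by (metis insertE)
    then show ?thesis using z(1) by blast
  qed
qed

definition flag_of :: "'a \<Rightarrow> (int \<times> 'a set) set" where
  "flag_of g = (\<lambda>i. face i g) ` {-1..n}"

lemma flag_of_chain: "g \<in> carrier G \<Longrightarrow> pred_on.chain (carrier K) (le K) (flag_of g)"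
  unfolding pred_on.chain_def flag_of_def
  by (auto simp: face_in_carrier) (metis atLeastAtMost_iff coset_le_faceI linorder_linear)

text \<open>The rank is injective on a chain, so a flag is finite and has a common element
  \<open>g\<close>. It is then contained in the chain \<open>flag_of g\<close>, and maximality gives
  equality.\<close>

lemma flag_eq_flag_of:
  assumes "is_flag K \<Phi>"
  obtains g where "g \<in> carrier G" "\<Phi> = flag_of g"
proof -
  have chain: "pred_on.chain (carrier K) (le K) \<Phi>"
    and max: "\<And>S. pred_on.chain (carrier K) (le K) S \<Longrightarrow> \<not> \<Phi> \<subset> S"
    using assms unfolding is_flag_def pred_on.maxchain_def by blast+
  have sub: "\<Phi> \<subseteq> carrier K" and lin: "\<And>F H. F \<in> \<Phi> \<Longrightarrow> H \<in> \<Phi> \<Longrightarrow> F \<sqsubseteq>\<^bsub>K\<^esub> H \<or> H \<sqsubseteq>\<^bsub>K\<^esub> F"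
    using chain complex_refl unfolding pred_on.chain_def by blast+
  have "inj_on fst \<Phi>"
  proof (rule inj_onI)
    fix F H assume *: "F \<in> \<Phi>" "H \<in> \<Phi>" "fst F = fst H"
    then have "F \<in> carrier K" "H \<in> carrier K" using sub by auto
    then show "F = H"
      using lin[OF *(1,2)] *(3) complex_antisym[of F H] complex_antisym[of H F] by auto
  qed
  moreover have "fst ` \<Phi> \<subseteq> {-1..n}"
    using sub fst_carrier by blast
  ultimately have "finite \<Phi>"
    by (meson finite_atLeastAtMost_int finite_imageD finite_subset)
  then obtain g where g: "g \<in> carrier G" "\<forall>F\<in>\<Phi>. F = face (fst F) g"
    using chain_common_element sub lin by meson
  then have "\<Phi> \<subseteq> flag_of g"
    using \<open>fst ` \<Phi> \<subseteq> {-1..n}\<close> unfolding flag_of_def by blast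
  then show ?thesis
    using max[OF flag_of_chain[OF g(1)]] g(1) that by blast
qed

lemma right_translation_iso:
  assumes h: "h \<in> carrier G"
  shows "order_iso (\<lambda>(i, C). (i, C #> h)) K K"
proof -
  define f where "f = (\<lambda>(i :: int, C). (i, C #> h))"
  have f: "f (face i x) = face i (x \<otimes> h)" if "x \<in> carrier G" for i x
    using that h subgroup.subset[OF std_subgroup] by (simp add: f_def face_def coset_mult_assoc)
  have le: "f F \<sqsubseteq>\<^bsub>K\<^esub> f H \<longleftrightarrow> F \<sqsubseteq>\<^bsub>K\<^esub> H" if FH: "F \<in> carrier K" "H \<in> carrier K" for F H
  proof -
    obtain i x where F: "i \<in> {-1..n}" "x \<in> carrier G" "F = face i x"
      using FH(1) by (rule carrier_faceE)
    obtain j y where H: "j \<in> {-1..n}" "y \<in> carrier G" "H = face j y"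
      using FH(2) by (rule carrier_faceE)
    \<comment> \<open>Right multiplication by \<open>h\<close> permutes the group, so a common
      element may be written as \<open>z \<otimes> h\<close>.\<close>
    have "(\<exists>z\<in>carrier G. face i z = face i (x \<otimes> h) \<and> face j z = face j (y \<otimes> h)) \<longleftrightarrow>
      (\<exists>z\<in>carrier G. face i (z \<otimes> h) = face i (x \<otimes> h) \<and> face j (z \<otimes> h) = face j (y \<otimes> h))"
      using h by (metis inv_closed inv_solve_right m_closed)
    then show ?thesis
      using F H h by (simp add: f coset_le_face_iff face_mult_right del: atLeastAtMost_iff)
  qed
  have "f ` carrier K = carrier K"
  proof
    show "f ` carrier K \<subseteq> carrier K"
      using f h by (auto elim!: carrier_faceE intro!: face_in_carrier)
    show "carrier K \<subseteq> f ` carrier K"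
    proof
      fix F assume "F \<in> carrier K"
      then obtain i x where F: "i \<in> {-1..n}" "x \<in> carrier G" "F = face i x"
        by (rule carrier_faceE)
      then have "F = f (face i (x \<otimes> inv h))" using f h by (simp add: m_assoc)
      then show "F \<in> f ` carrier K" using F h by (simp add: face_in_carrier)
    qed
  qed
  moreover have "inj_on f (carrier K)"
  proof (rule inj_onI)
    fix F H assume *: "F \<in> carrier K" "H \<in> carrier K" "f F = f H"
    then have "fst F = fst H" by (auto simp: f_def split: prod.splits)
    \<comment> \<open>Injectivity comes from reflection of the order: equal images are incident,
      hence so are \<open>F\<close> and \<open>H\<close>.\<close>
    moreover have "F \<sqsubseteq>\<^bsub>K\<^esub> H"
      using le[OF *(1,2)] le[OF *(2,2)] * complex_refl by simp
    ultimately show "F = H" using complex_antisym * by simp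
  qed
  ultimately show ?thesis
    using le unfolding order_iso_def bij_betw_def f_def by blast
qed

lemma flag_transitivity:
  assumes "is_flag K \<Phi>" "is_flag K \<Psi>"
  shows "\<exists>f. order_iso f K K \<and> f ` \<Phi> = \<Psi>"
proof -
  obtain g where g: "g \<in> carrier G" "\<Phi> = flag_of g" using assms(1) by (rule flag_eq_flag_of)
  obtain h where h: "h \<in> carrier G" "\<Psi> = flag_of h" using assms(2) by (rule flag_eq_flag_of)
  have "g \<otimes> (inv g \<otimes> h) = h" using g h by (simp add: m_assoc[symmetric])
  then have "(\<lambda>(i, C). (i, C #> (inv g \<otimes> h))) ` \<Phi> = \<Psi>"
    using g h subgroup.subset[OF std_subgroup]
    by (simp add: flag_of_def face_def coset_mult_assoc image_image)
  then show ?thesis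
    using right_translation_iso[of "inv g \<otimes> h"] g h by blast
qed

text \<open>Every proper face is joined to the face of rank \<open>i + 1\<close> of the base flag:
  first pass to rank \<open>i + 1\<close> within the flag of the same group element, then strip that
  element of its generators one by one. The gap of 3 makes both \<open>i + 1\<close> and
  \<open>i + 2\<close> proper ranks.\<close>

lemma section_connected_faces:
  assumes i: "i \<in> {-1..n}" and j: "j \<in> {-1..n}" and ij: "i + 3 \<le> j" and g: "g \<in> carrier G"
  shows "section_connected K (face i g) (face j g)"
proof -
  define S where "S = proper_faces K (face i g) (face j g)"
  define T where "T = {(u, v). u \<in> S \<and> v \<in> S \<and> (u \<sqsubseteq>\<^bsub>K\<^esub> v \<or> v \<sqsubseteq>\<^bsub>K\<^esub> u)}"
  define \<Lambda> where "\<Lambda> = std {i<..<j}"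
  have \<Lambda>c: "v \<in> carrier G" if "v \<in> \<Lambda>" for v using that std_carrier by (simp add: \<Lambda>_def)
  have triv: "face i (v \<otimes> g) = face i g" "face j (v \<otimes> g) = face j g" if "v \<in> \<Lambda>" for v
    using that g std_mono[of "{i<..<j}" "- {i}"] std_mono[of "{i<..<j}" "- {j}"]
    by (auto simp: \<Lambda>_def intro!: face_mult_left)
  have S_iff: "F \<in> S \<longleftrightarrow> (\<exists>k\<in>{i<..<j}. \<exists>v\<in>\<Lambda>. F = face k (v \<otimes> g))" for F
  proof
    assume "F \<in> S"
    then obtain k v where F: "k \<in> {i..j}" "v \<in> \<Lambda>" "F = face k (v \<otimes> g)" "F \<noteq> face i g" "F \<noteq> face j g"
      unfolding S_def proper_faces_def section_carrier[OF i j g] \<Lambda>_def by auto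
    then have "k \<noteq> i" "k \<noteq> j" using triv by auto
    then show "\<exists>k\<in>{i<..<j}. \<exists>v\<in>\<Lambda>. F = face k (v \<otimes> g)" using F by force
  next
    assume "\<exists>k\<in>{i<..<j}. \<exists>v\<in>\<Lambda>. F = face k (v \<otimes> g)"
    then obtain k v where F: "k \<in> {i<..<j}" "v \<in> \<Lambda>" "F = face k (v \<otimes> g)" by blast
    then have "F \<noteq> face i g" "F \<noteq> face j g" by (auto simp: face_def)
    moreover have "F \<in> (\<lambda>(k, v). face k (v \<otimes> g)) ` ({i..j} \<times> std {i<..<j})"
      using F by (intro image_eqI[of _ _ "(k, v)"]) (auto simp: \<Lambda>_def)
    ultimately show "F \<in> S"
      unfolding S_def proper_faces_def section_carrier[OF i j g] by simp
  qed
  have step: "(face k (v \<otimes> g), face l (v \<otimes> g)) \<in> T"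
    if "k \<in> {i<..<j}" "l \<in> {i<..<j}" "v \<in> \<Lambda>" for k l v
  proof -
    have "k \<in> {-1..n}" "l \<in> {-1..n}" using that i j by auto
    then have "face k (v \<otimes> g) \<sqsubseteq>\<^bsub>K\<^esub> face l (v \<otimes> g) \<or> face l (v \<otimes> g) \<sqsubseteq>\<^bsub>K\<^esub> face k (v \<otimes> g)"
      using coset_le_faceI[of _ _ "v \<otimes> g"] \<Lambda>c[OF that(3)] g by (metis linorder_linear m_closed)
    then show ?thesis unfolding T_def using S_iff that by blast
  qed
  have k0: "i + 1 \<in> {i<..<j}" "i + 2 \<in> {i<..<j}" using ij by auto
  text \<open>A generator in \<open>R l\<close> fixes all faces of rank other than \<open>l\<close> on the base flag, and there
    are at least two proper ranks.\<close>
  have fixed: "face m (r \<otimes> w \<otimes> g) = face m (w \<otimes> g)"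
    if "w \<in> \<Lambda>" "r \<in> std (- {m})" for r w m
    using that g \<Lambda>c std_carrier by (simp add: m_assoc face_mult_left)
  \<comment> \<open>The free factor \<open>w\<close> serves the product case: \<open>x\<close> is
    stripped in front of \<open>y \<otimes> w\<close>, then \<open>y\<close> in front of
    \<open>w\<close>.\<close>
  have "\<forall>w\<in>\<Lambda>. (face (i + 1) (v \<otimes> w \<otimes> g), face (i + 1) (w \<otimes> g)) \<in> T\<^sup>*" if "v \<in> \<Lambda>" for v
    using that[unfolded \<Lambda>_def]
  proof (induction rule: std_induct)
    case (base r)
    then show ?case using fixed base_subset_std by (metis rtrancl.rtrancl_refl subsetD)
  next
    case (R r l)
    show ?case
    proof
      fix w assume w: "w \<in> \<Lambda>"
      have rw: "r \<otimes> w \<in> \<Lambda>"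
        using std_mult R_subset_std[OF R(1,2)] R(3) w unfolding \<Lambda>_def by blast
      show "(face (i + 1) (r \<otimes> w \<otimes> g), face (i + 1) (w \<otimes> g)) \<in> T\<^sup>*"
      proof (cases "l = i + 1")
        case False
        then have "r \<in> std (- {i + 1})" using R R_subset_std[of l "- {i + 1}"] by auto
        then show ?thesis using fixed[OF w] by simp
      next
        case True
        then have "r \<in> std (- {i + 2})" using R R_subset_std[of l "- {i + 2}"] by auto
        then have "face (i + 2) (r \<otimes> w \<otimes> g) = face (i + 2) (w \<otimes> g)" using fixed[OF w] by simp
        then show ?thesis
          using step[OF k0 rw] step[OF k0(2,1) w] by (metis r_into_rtrancl rtrancl.rtrancl_into_rtrancl)
      qed
    qed
  next
    case (mult x y)
    show ?case
    proof
      fix w assume w: "w \<in> \<Lambda>"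
      then have "y \<otimes> w \<in> \<Lambda>" using mult.hyps std_mult unfolding \<Lambda>_def by blast
      then have "(face (i + 1) (x \<otimes> (y \<otimes> w) \<otimes> g), face (i + 1) (y \<otimes> w \<otimes> g)) \<in> T\<^sup>*"
        using mult.IH(1) by blast
      also have "(face (i + 1) (y \<otimes> w \<otimes> g), face (i + 1) (w \<otimes> g)) \<in> T\<^sup>*"
        using mult.IH(2) w by blast
      finally show "(face (i + 1) (x \<otimes> y \<otimes> w \<otimes> g), face (i + 1) (w \<otimes> g)) \<in> T\<^sup>*"
        using mult.hyps[THEN std_carrier] \<Lambda>c[OF w] by (simp add: m_assoc)
    qed
  qed
  moreover have one: "\<one> \<in> \<Lambda>" unfolding \<Lambda>_def by (rule subgroup.one_closed[OF std_subgroup])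
  ultimately have to_base: "(face (i + 1) (v \<otimes> g), face (i + 1) g) \<in> T\<^sup>*" if "v \<in> \<Lambda>" for v
    using that \<Lambda>c g by (metis l_one r_one)
  have base: "(F, face (i + 1) g) \<in> T\<^sup>*" if F_in: "F \<in> S" for F
  proof -
    obtain k v where F: "k \<in> {i<..<j}" "v \<in> \<Lambda>" "F = face k (v \<otimes> g)"
      using F_in unfolding S_iff by blast
    show ?thesis
      unfolding F(3) by (rule converse_rtrancl_into_rtrancl[OF step[OF F(1) k0(1) F(2)] to_base[OF F(2)]])
  qed
  have "sym (T\<^sup>*)" by (rule sym_rtrancl) (auto simp: sym_def T_def)
  then have "(F, H) \<in> T\<^sup>*" if "F \<in> S" "H \<in> S" for F H
    using base[OF that(1)] base[OF that(2)] by (meson rtrancl_trans symD)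
  then show ?thesis
    unfolding section_connected_def S_def[symmetric] T_def[symmetric] by blast
qed

text \<open>This is \<open>section_carrier\<close> for the ranks \<open>i - 1\<close> and
  \<open>i + 1\<close>: the only index strictly between is \<open>i\<close>, so the group of the
  section is \<open>R i\<close>.\<close>

lemma faces_between:
  assumes i: "i \<in> {0..n - 1}" and g: "g \<in> carrier G"
  shows "{E \<in> faces_of_rank G R n i. face (i - 1) g \<sqsubseteq>\<^bsub>K\<^esub> E \<and> E \<sqsubseteq>\<^bsub>K\<^esub> face (i + 1) g}
    = (\<lambda>v. face i (v \<otimes> g)) ` R i"
proof -
  have "{E \<in> faces_of_rank G R n i. face (i - 1) g \<sqsubseteq>\<^bsub>K\<^esub> E \<and> E \<sqsubseteq>\<^bsub>K\<^esub> face (i + 1) g}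
      = {E \<in> \<lbrace>face (i - 1) g..face (i + 1) g\<rbrace>\<^bsub>K\<^esub>. fst E = i}"
    using i by (auto simp: at_least_at_most_def carrier_complex faces_of_rank_eq)
  also have "\<dots> = (\<lambda>v. face i (v \<otimes> g)) ` std {i - 1<..<i + 1}"
    using i g by (subst section_carrier) (auto intro: image_eqI[of _ _ "(i, _)"])
  also have "{i - 1<..<i + 1} = {i}" by auto
  finally show ?thesis using std_singleton[OF i] by simp
qed

text \<open>By the intersection property \<open>R i\<close> meets the subgroup of a face of rank
  \<open>i\<close> in \<open>R (-1)\<close> only.\<close>

lemma face_R_eq_iff:
  assumes i: "i \<in> {0..n - 1}" and g: "g \<in> carrier G" and u: "u \<in> R i" and v: "v \<in> R i"
  shows "face i (u \<otimes> g) = face i (v \<otimes> g) \<longleftrightarrow> R (-1) #> u = R (-1) #> v"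
proof -
  have c: "u \<in> carrier G" "v \<in> carrier G" "u \<otimes> inv v \<in> std {i}"
    using u v subgroup_R[of i] i std_singleton[OF i] std_carrier
    by (auto intro: subgroup.m_closed subgroup.m_inv_closed simp: subgroup.mem_carrier)
  have "std (- {i}) \<inter> std {i} = R (-1)"
    unfolding std_Int by (rule std_empty) auto
  then have "u \<otimes> inv v \<in> std (- {i}) \<longleftrightarrow> u \<otimes> inv v \<in> R (-1)" using c by blast
  then show ?thesis
    using face_mult_right[OF c(1,2) g] face_eq_iff[OF c(1,2)]
      r_coset_eq_iff[OF base_subgroup c(1,2)] by simp
qed

lemma complex_regular: "regular_incidence_complex K fst n"
proof -
  interpret partial_order K by (rule complex_partial_order)
  show ?thesis
  proof
    have n: "-1 \<in> {-1..n}" "n \<in> {-1..n}" using rank_nonneg by auto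
    have bounds: "face (-1) \<one> \<sqsubseteq>\<^bsub>K\<^esub> F \<and> F \<sqsubseteq>\<^bsub>K\<^esub> face n \<one>" if F_in: "F \<in> carrier K" for F
    proof -
      obtain i x where F: "i \<in> {-1..n}" "x \<in> carrier G" "F = face i x"
        using F_in by (rule carrier_faceE)
      have "face (-1) \<one> = face (-1) x" "face n \<one> = face n x"
        using F(2) by (auto intro: face_improper)
      then show ?thesis
        using F coset_le_faceI[OF n(1) F(1) _ F(2)] coset_le_faceI[OF F(1) n(2) _ F(2)] by simp
    qed
    have "least K (face (-1) \<one>) (carrier K)"
      unfolding least_def using bounds face_in_carrier[OF n(1)] by blast
    then show "\<exists>x. least K x (carrier K)" by blast
    have "greatest K (face n \<one>) (carrier K)"
      unfolding greatest_def using bounds face_in_carrier[OF n(2)] by blast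
    then show "\<exists>x. greatest K x (carrier K)" by blast
  next
    fix x assume "x \<in> carrier K"
    then show "fst x \<in> {-1..n}" by (rule fst_carrier)
  next
    fix x y assume *: "x \<in> carrier K" "y \<in> carrier K" "x \<sqsubset>\<^bsub>K\<^esub> y"
    then have "x \<sqsubseteq>\<^bsub>K\<^esub> y" "x \<noteq> y" by (auto simp: lless_def eq_complex)
    then show "fst x < fst y" using complex_antisym[OF *(1,2)] by (meson not_le_imp_less)
  next
    fix \<Phi> assume "is_flag K \<Phi>"
    then obtain g where "\<Phi> = flag_of g" by (rule flag_eq_flag_of)
    moreover have "inj_on (\<lambda>i. face i g) {-1..n}" by (auto simp: inj_on_def face_def)
    ultimately show "finite \<Phi> \<and> int (card \<Phi>) = n + 2"
      using rank_nonneg by (simp add: flag_of_def card_image)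
  next
    fix x y assume *: "x \<in> carrier K" "y \<in> carrier K" "x \<sqsubseteq>\<^bsub>K\<^esub> y" "2 \<le> fst y - fst x - 1"
    obtain g where g: "g \<in> carrier G" "x = face (fst x) g" "y = face (fst y) g"
      using *(1-3) by (rule coset_le_faceE)
    have "section_connected K (face (fst x) g) (face (fst y) g)"
      using *(4) by (intro section_connected_faces fst_carrier * g(1)) simp
    then show "section_connected K x y" using g(2,3) by metis
  next
    fix i x y
    assume i: "i \<in> {0..n - 1}" and xy: "x \<in> carrier K" "y \<in> carrier K"
      and rk: "fst x = i - 1" "fst y = i + 1" and le: "x \<sqsubseteq>\<^bsub>K\<^esub> y"
    obtain g where g: "g \<in> carrier G" "x = face (i - 1) g" "y = face (i + 1) g"
      using xy le rk by (metis coset_le_faceE)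
    \<comment> \<open>Properness of \<open>R (-1)\<close> in \<open>R i\<close> supplies the second
      face; the first one comes from the unit.\<close>
    obtain r where r: "r \<in> R i" "r \<notin> R (-1)" using R_proper[OF i] by blast
    have s: "subgroup (R i) G" using subgroup_R i by simp
    have "face i (r \<otimes> g) \<noteq> face i (\<one> \<otimes> g)"
      using face_R_eq_iff[OF i g(1) r(1) subgroup.one_closed[OF s]] r
        r_coset_eq_iff[OF base_subgroup] subgroup.mem_carrier[OF s] by simp
    moreover have "face i (r \<otimes> g) \<in> \<lbrace>x..y\<rbrace>\<^bsub>K\<^esub>" "face i (\<one> \<otimes> g) \<in> \<lbrace>x..y\<rbrace>\<^bsub>K\<^esub>"
    proof -
      have "face i (v \<otimes> g) \<in> \<lbrace>x..y\<rbrace>\<^bsub>K\<^esub>" if "v \<in> R i" for v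
      proof -
        have "face i (v \<otimes> g) \<in> {E \<in> faces_of_rank G R n i. x \<sqsubseteq>\<^bsub>K\<^esub> E \<and> E \<sqsubseteq>\<^bsub>K\<^esub> y}"
          unfolding g(2,3) faces_between[OF i g(1)] using that by blast
        then show ?thesis
          using i by (auto simp: at_least_at_most_def carrier_complex faces_of_rank_eq)
      qed
      then show "face i (r \<otimes> g) \<in> \<lbrace>x..y\<rbrace>\<^bsub>K\<^esub>" "face i (\<one> \<otimes> g) \<in> \<lbrace>x..y\<rbrace>\<^bsub>K\<^esub>"
        using r subgroup.one_closed[OF s] by blast+
    qed
    ultimately show "\<exists>h h'. h \<noteq> h' \<and> h \<in> \<lbrace>x..y\<rbrace>\<^bsub>K\<^esub> \<and> h' \<in> \<lbrace>x..y\<rbrace>\<^bsub>K\<^esub> \<and> fst h = i \<and> fst h' = i"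
      by (metis fst_face)
  next
    fix \<Phi> \<Psi> assume "is_flag K \<Phi>" "is_flag K \<Psi>"
    then show "\<exists>f. order_iso f K K \<and> f ` \<Phi> = \<Psi>" by (rule flag_transitivity)
  qed
qed

section \<open>Sections\<close>

definition section_group :: "int \<Rightarrow> int \<Rightarrow> ('a, 'b) monoid_scheme" where
  "section_group i j = G\<lparr>carrier := std {i<..<j}\<rparr>"

text \<open>At \<open>k = j - i - 1\<close> the shifted index would give \<open>R j\<close>, which
  for proper \<open>j\<close> is larger than \<open>R (-1)\<close>; the last distinguished subgroup
  has to be \<open>R n\<close> instead.\<close>

definition section_R :: "int \<Rightarrow> int \<Rightarrow> int \<Rightarrow> 'a set" where
  "section_R i j = (\<lambda>k. if k = -1 then R (-1) else if k = j - i - 1 then R n else R (i + 1 + k))"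

lemma section_group_simps [simp]:
  "carrier (section_group i j) = std {i<..<j}"
  "x \<otimes>\<^bsub>section_group i j\<^esub> y = x \<otimes> y"
  "A <#>\<^bsub>section_group i j\<^esub> B = A <#> B"
  "A #>\<^bsub>section_group i j\<^esub> x = A #> x"
  by (simp_all add: section_group_def set_mult_def r_coset_def)

lemma inv_section_group: "x \<in> std {i<..<j} \<Longrightarrow> inv\<^bsub>section_group i j\<^esub> x = inv x"
  unfolding section_group_def by (rule m_inv_consistent[OF std_subgroup])

text \<open>Generation inside \<open>\<Lambda>\<close> agrees with generation in \<open>G\<close>,
  so all subgroups of the section group become instances of \<open>std\<close>. The extreme indices
  \<open>-1\<close> and \<open>j - i - 1\<close> correspond to \<open>i\<close> and
  \<open>j\<close>, which lie outside the open interval and add nothing beyond the base.\<close>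

lemma gen_subgp_section:
  assumes i: "i \<in> {-1..n}" and j: "j \<in> {-1..n}" and ij: "i < j" and I: "I \<subseteq> {-1..j - i - 1}"
  shows "gen_subgp (section_group i j) (section_R i j) I = std {l \<in> {i<..<j}. l - i - 1 \<in> I}"
    (is "_ = std ?J")
proof (cases "I = {}")
  case True
  then show ?thesis by (simp add: gen_subgp_def section_R_def std_empty)
next
  case False
  have sub: "section_R i j k \<subseteq> R (-1) \<union> (\<Union>l\<in>?J \<inter> {0..n - 1}. R l)" if "k \<in> I" for k
  proof (cases "k = -1 \<or> k = j - i - 1")
    case True
    then show ?thesis by (auto simp: section_R_def R_last)
  next
    case False
    moreover have "k \<in> {-1..j - i - 1}" using that I by blast
    ultimately have "i + 1 + k \<in> ?J \<inter> {0..n - 1}" using that i j by auto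
    then show ?thesis using False by (auto simp: section_R_def)
  qed
  have sup: "R l \<subseteq> (\<Union>k\<in>I. section_R i j k)" if "l \<in> ?J" for l
    using that UN_upper[of "l - i - 1" I "section_R i j"] by (auto simp: section_R_def)
  have "R (-1) \<subseteq> section_R i j k" if "k \<in> I" for k
    using that I i j R_last base_subset_R[of "i + 1 + k"] by (fastforce simp: section_R_def)
  then have "R (-1) \<subseteq> (\<Union>k\<in>I. section_R i j k)"
    using False by blast
  then have eq: "(\<Union>k\<in>I. section_R i j k) = R (-1) \<union> (\<Union>l\<in>?J \<inter> {0..n - 1}. R l)"
    using sub sup by blast
  have "(\<Union>k\<in>I. section_R i j k) \<subseteq> std {i<..<j}"
    unfolding eq by (intro Un_least UN_least base_subset_std R_subset_std) auto
  then show ?thesis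
    using False generate_consistent[OF _ std_subgroup, of "\<Union>k\<in>I. section_R i j k" "{i<..<j}"]
    by (simp add: gen_subgp_def section_group_def eq std_def)
qed

text \<open>The intersection property is inherited through \<open>std_Int\<close>. Assuming only
  \<open>i < j\<close> includes the facets and vertex-figures of a complex of rank 1.\<close>

lemma section_string_C_group:
  assumes i: "i \<in> {-1..n}" and j: "j \<in> {-1..n}" and ij: "i < j"
  shows "generalized_string_C_group (section_group i j) (section_R i j) (j - i - 1)"
proof -
  have i': "-1 \<le> i" and j': "j \<le> n" using i j by auto
  show ?thesis
  proof (intro generalized_string_C_group.intro generalized_C_group.intro
      generalized_C_group_axioms.intro generalized_string_C_group_axioms.intro)
    show "group (section_group i j)"
      unfolding section_group_def by (rule subgroup_imp_group[OF std_subgroup])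
    show "0 \<le> j - i - 1" using ij by simp
    show "section_R i j (j - i - 1) = section_R i j (-1)" by (simp add: section_R_def R_last)
  next
    fix k assume k: "k \<in> {-1..j - i - 1}"
    have "section_R i j k \<subseteq> std {i<..<j}"
    proof (cases "k = -1 \<or> k = j - i - 1")
      case True
      then show ?thesis using base_subset_std by (auto simp: section_R_def R_last)
    next
      case False
      then show ?thesis using k i j R_subset_std[of "i + 1 + k" "{i<..<j}"] by (simp add: section_R_def)
    qed
    moreover have "subgroup (section_R i j k) G"
      using k i j subgroup_R[of "i + 1 + k"] base_subgroup R_last by (auto simp: section_R_def)
    ultimately show "subgroup (section_R i j k) (section_group i j)"
      unfolding section_group_def using subgroup_incl[OF _ std_subgroup] by blast
  next
    have "{l \<in> {i<..<j}. l - i - 1 \<in> {-1..j - i - 1}} = {i<..<j}" by auto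
    then show "generate (section_group i j) (\<Union>k\<in>{-1..j - i - 1}. section_R i j k)
        = carrier (section_group i j)"
      using gen_subgp_section[OF i j ij order_refl] ij by (simp add: gen_subgp_def)
  next
    fix k assume "k \<in> {0..j - i - 1 - 1}"
    then show "section_R i j (-1) \<subset> section_R i j k"
      using i j R_proper[of "i + 1 + k"] by (auto simp: section_R_def)
  next
    fix I J assume IJ: "I \<subseteq> {-1..j - i - 1}" "J \<subseteq> {-1..j - i - 1}"
    have "I \<inter> J \<subseteq> {-1..j - i - 1}" using IJ by blast
    moreover have "{l \<in> {i<..<j}. l - i - 1 \<in> I} \<inter> {l \<in> {i<..<j}. l - i - 1 \<in> J} =
        {l \<in> {i<..<j}. l - i - 1 \<in> I \<inter> J}" by blast
    ultimately show "gen_subgp (section_group i j) (section_R i j) I \<inter>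
        gen_subgp (section_group i j) (section_R i j) J =
        gen_subgp (section_group i j) (section_R i j) (I \<inter> J)"
      using IJ by (simp only: gen_subgp_section[OF i j ij] std_Int)
  next
    fix k l assume kl: "-1 \<le> k" "k < l - 1" "l - 1 \<le> j - i - 1 - 1"
    have k': "section_R i j k = (if k = -1 then R (-1) else R (i + 1 + k))"
      using kl by (simp add: section_R_def)
    have l': "section_R i j l = (if l = j - i - 1 then R n else R (i + 1 + l))"
      using kl by (simp add: section_R_def)
    \<comment> \<open>An extreme index stands for \<open>R (-1)\<close> or \<open>R n\<close>, so
      \<open>string\<close> is applied at \<open>-1\<close> or \<open>n\<close> there and at the
      shifted indices otherwise.\<close>
    have "R (-1) <#> R (i + 1 + l) = R (i + 1 + l) <#> R (-1)"
      by (rule string) (use kl i' j' in linarith)+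
    moreover have "R (i + 1 + k) <#> R n = R n <#> R (i + 1 + k)" if "l = j - i - 1"
      by (rule string) (use kl i' j' that in linarith)+
    moreover have "R (i + 1 + k) <#> R (i + 1 + l) = R (i + 1 + l) <#> R (i + 1 + k)"
      by (rule string) (use kl i' j' in linarith)+
    ultimately show "section_R i j k <#>\<^bsub>section_group i j\<^esub> section_R i j l =
        section_R i j l <#>\<^bsub>section_group i j\<^esub> section_R i j k"
      unfolding section_group_simps k' l' by (simp add: R_last)
  qed
qed

text \<open>Both posets are labelled by pairs of a rank in \<open>{i..j}\<close> and an element of
  \<open>\<Lambda>\<close>, and incidence in both means having a common element. The main point is
  that two faces of the section with a common element in \<open>G\<close> also share one of the form
  \<open>u \<otimes> g\<close> with \<open>u\<close> in \<open>\<Lambda>\<close>.\<close>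

lemma section_isomorphic:
  assumes i: "i \<in> {-1..n}" and j: "j \<in> {-1..n}" and ij: "i < j" and g: "g \<in> carrier G"
  shows "order_isomorphic (poset_section K (face i g) (face j g))
    (coset_complex (section_group i j) (section_R i j) (j - i - 1))"
proof -
  interpret L: generalized_string_C_group "section_group i j" "section_R i j" "j - i - 1"
    by (rule section_string_C_group[OF i j ij])
  let ?\<Lambda> = "std {i<..<j}"
  have \<Lambda>c: "v \<in> carrier G" if "v \<in> ?\<Lambda>" for v using that by (rule std_carrier)
  have triv: "face i (v \<otimes> g) = face i g" "face j (v \<otimes> g) = face j g" if "v \<in> ?\<Lambda>" for v
    using that g std_mono[of "{i<..<j}" "- {i}"] std_mono[of "{i<..<j}" "- {j}"]
    by (auto intro!: face_mult_left)
  \<comment> \<open>The subgroup of rank \<open>k - i - 1\<close> in the complex of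
    \<open>\<Lambda>\<close> is the intersection of \<open>\<Lambda>\<close> with the subgroup of
    rank \<open>k\<close> in \<open>G\<close>, and quotients of elements of \<open>\<Lambda>\<close>
    stay in \<open>\<Lambda>\<close>.\<close>
  have L_face_eq: "L.face (k - i - 1) v = L.face (k - i - 1) w \<longleftrightarrow> face k v = face k w"
    if k: "k \<in> {i..j}" and vw: "v \<in> ?\<Lambda>" "w \<in> ?\<Lambda>" for k v w
  proof -
    have "{l \<in> {i<..<j}. l - i - 1 \<in> {-1..j - i - 1} - {k - i - 1}} = {i<..<j} \<inter> - {k}" by auto
    then have "face_subgp (section_group i j) (section_R i j) (j - i - 1) (k - i - 1) = ?\<Lambda> \<inter> std (- {k})"
      unfolding face_subgp_def by (subst gen_subgp_section[OF i j ij]) (auto simp: std_Int)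
    then have "L.std (- {k - i - 1}) = ?\<Lambda> \<inter> std (- {k})"
      using L.face_subgp_eq_std[of "k - i - 1"] k by simp
    moreover have "v \<otimes> inv w \<in> ?\<Lambda>" using vw by (intro std_mult std_inv)
    ultimately show ?thesis
      using vw \<Lambda>c by (simp add: L.face_eq_iff face_eq_iff inv_section_group)
  qed
  define a where "a = (\<lambda>(k, v). face k (v \<otimes> g))"
  define b where "b = (\<lambda>(k, v). L.face (k - i - 1) v)"
  have le: "a p \<sqsubseteq>\<^bsub>K\<^esub> a q \<longleftrightarrow> b p \<sqsubseteq>\<^bsub>L.K\<^esub> b q"
    if pq: "p \<in> {i..j} \<times> ?\<Lambda>" "q \<in> {i..j} \<times> ?\<Lambda>" for p q
  proof -
    obtain k v l w where p: "p = (k, v)" "k \<in> {i..j}" "v \<in> ?\<Lambda>" and q: "q = (l, w)" "l \<in> {i..j}" "w \<in> ?\<Lambda>"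
      using pq by auto
    have kl: "k \<in> {-1..n}" "l \<in> {-1..n}" "k - i - 1 \<in> {-1..j - i - 1}" "l - i - 1 \<in> {-1..j - i - 1}"
      using p q i j by auto
    note c = \<Lambda>c[OF p(3)] \<Lambda>c[OF q(3)]
    have "a p \<sqsubseteq>\<^bsub>K\<^esub> a q \<longleftrightarrow>
        k \<le> l \<and> (\<exists>z\<in>carrier G. face k z = face k (v \<otimes> g) \<and> face l z = face l (w \<otimes> g))"
      using coset_le_face_iff[OF kl(1,2), of "v \<otimes> g" "w \<otimes> g"] c g by (simp add: a_def p(1) q(1))
    also have "\<dots> \<longleftrightarrow> k \<le> l \<and> (\<exists>z\<in>?\<Lambda>. face k z = face k v \<and> face l z = face l w)"
    proof (intro conj_cong refl iffI)
      assume kl': "k \<le> l"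
      assume "\<exists>z\<in>carrier G. face k z = face k (v \<otimes> g) \<and> face l z = face l (w \<otimes> g)"
      then obtain z where z: "z \<in> carrier G" "face k z = face k (v \<otimes> g)" "face l z = face l (w \<otimes> g)"
        by blast
      text \<open>Replace \<open>z\<close> by an element on the full chain
        \<open>face i g \<le> face k (v g) \<le> face l (w g) \<le> face j g\<close>.\<close>
      obtain z1 where z1: "z1 \<in> carrier G" "\<And>m. m \<le> k \<Longrightarrow> face m z1 = face m (v \<otimes> g)"
          "\<And>m. m \<ge> k \<Longrightarrow> face m z1 = face m z"
        using glue[OF _ z(1) z(2)[symmetric]] c g by (metis m_closed)
      have "face l z1 = face l (w \<otimes> g)" using z1(3) z(3) kl' by simp
      then obtain z2 where z2: "z2 \<in> carrier G" "\<And>m. m \<le> l \<Longrightarrow> face m z2 = face m z1"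
          "\<And>m. m \<ge> l \<Longrightarrow> face m z2 = face m (w \<otimes> g)"
        using glue[OF z1(1)] c g by (metis m_closed)
      have "face i z2 = face i g" "face j z2 = face j g" "face k z2 = face k (v \<otimes> g)"
          "face l z2 = face l (w \<otimes> g)"
        using z1(2)[of i] z1(2)[of k] z2(2)[of i] z2(2)[of k] z2(3)[of l] z2(3)[of j] kl' p(2,3) q(2,3) triv
        by auto
      then obtain u where u: "u \<in> ?\<Lambda>" "face k (u \<otimes> g) = face k (v \<otimes> g)" "face l (u \<otimes> g) = face l (w \<otimes> g)"
        using section_representative[OF g z2(1), of i j] p q by metis
      then show "\<exists>z\<in>?\<Lambda>. face k z = face k v \<and> face l z = face l w"
        using c g \<Lambda>c[OF u(1)] by (auto simp: face_mult_right)
    next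
      assume "\<exists>z\<in>?\<Lambda>. face k z = face k v \<and> face l z = face l w"
      then obtain z where z: "z \<in> ?\<Lambda>" "face k z = face k v" "face l z = face l w" by blast
      then have "face k (z \<otimes> g) = face k (v \<otimes> g) \<and> face l (z \<otimes> g) = face l (w \<otimes> g)"
        using c g \<Lambda>c[OF z(1)] by (simp add: face_mult_right)
      then show "\<exists>z\<in>carrier G. face k z = face k (v \<otimes> g) \<and> face l z = face l (w \<otimes> g)"
        using g \<Lambda>c[OF z(1)] by blast
    qed
    also have "\<dots> \<longleftrightarrow> k - i - 1 \<le> l - i - 1 \<and> (\<exists>z\<in>?\<Lambda>. L.face (k - i - 1) z = L.face (k - i - 1) v \<and>
        L.face (l - i - 1) z = L.face (l - i - 1) w)"
      using L_face_eq p q by auto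
    also have "\<dots> \<longleftrightarrow> b p \<sqsubseteq>\<^bsub>L.K\<^esub> b q"
      using L.coset_le_face_iff[OF kl(3,4), of v w] p q by (simp add: b_def)
    finally show ?thesis .
  qed
  show ?thesis
  proof (rule order_isomorphic_images)
    show "partial_order (poset_section K (face i g) (face j g))"
      unfolding poset_section_def
      by (rule partial_order_subset[OF complex_partial_order]) (auto simp: at_least_at_most_def)
    show "partial_order L.K" by (rule L.complex_partial_order)
    show "carrier (poset_section K (face i g) (face j g)) = a ` ({i..j} \<times> ?\<Lambda>)"
      unfolding poset_section_def a_def using section_carrier[OF i j g] by simp
    show "carrier L.K = b ` ({i..j} \<times> ?\<Lambda>)"
    proof (intro equalityI subsetI)
      fix F assume "F \<in> carrier L.K"
      then obtain k v where "k \<in> {-1..j - i - 1}" "v \<in> ?\<Lambda>" "F = L.face k v"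
        by (auto elim: L.carrier_faceE)
      then show "F \<in> b ` ({i..j} \<times> ?\<Lambda>)"
        by (intro image_eqI[of _ _ "(k + i + 1, v)"]) (auto simp: b_def)
    next
      fix F assume "F \<in> b ` ({i..j} \<times> ?\<Lambda>)"
      then show "F \<in> carrier L.K" by (auto simp: b_def intro!: L.face_in_carrier)
    qed
  qed (use le in \<open>simp add: poset_section_def\<close>)
qed

lemma section_isomorphic_faces:
  assumes "i \<in> {-1..n}" "j \<in> {-1..n}" "i < j"
    and "F \<in> faces_of_rank G R n i" "H \<in> faces_of_rank G R n j" "F \<sqsubseteq>\<^bsub>K\<^esub> H"
  shows "order_isomorphic (poset_section K F H)
    (coset_complex (section_group i j) (section_R i j) (j - i - 1))"
proof -
  have "F \<in> carrier K" "H \<in> carrier K" "fst F = i" "fst H = j"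
    using assms(1,2,4,5) by (auto simp: faces_of_rank_eq face_in_carrier)
  then show ?thesis
    using coset_le_faceE[OF _ _ assms(6)] section_isomorphic[OF assms(1-3)] by metis
qed

text \<open>The freedom in \<open>g\<close> allows the representative of a facet to be used for the
  least face too.\<close>

lemma least_face_eq: "g \<in> carrier G \<Longrightarrow> least_face G = face (-1) g"
  using std_all[of "- {-1}"] coset_join2[OF _ std_subgroup, of g "- {-1}"]
  by (auto simp: least_face_def face_def)

lemma greatest_face_eq: "g \<in> carrier G \<Longrightarrow> greatest_face G n = face n g"
  using std_all[of "- {n}"] coset_join2[OF _ std_subgroup, of g "- {n}"]
  by (auto simp: greatest_face_def face_def)

text \<open>The index is expressed by the set of right cosets, so infinite indices are covered as
  well. Over the label set \<open>R i\<close>, faces and cosets have the same fibres by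
  \<open>face_R_eq_iff\<close>.\<close>

lemma faces_between_eqpoll:
  assumes i: "i \<in> {0..n - 1}" and F: "F \<in> faces_of_rank G R n (i - 1)"
    and H: "H \<in> faces_of_rank G R n (i + 1)" and le: "F \<sqsubseteq>\<^bsub>K\<^esub> H"
  shows "{E \<in> faces_of_rank G R n i. F \<sqsubseteq>\<^bsub>K\<^esub> E \<and> E \<sqsubseteq>\<^bsub>K\<^esub> H}
    \<approx> rcosets\<^bsub>G\<lparr>carrier := R i\<rparr>\<^esub> (R (-1))"
proof -
  have r: "i - 1 \<in> {-1..n}" "i + 1 \<in> {-1..n}" using i by auto
  have "F \<in> carrier K" "H \<in> carrier K" "fst F = i - 1" "fst H = i + 1"
    using F H r by (auto simp: faces_of_rank_eq face_in_carrier)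
  then obtain g where g: "g \<in> carrier G" "F = face (i - 1) g" "H = face (i + 1) g"
    using coset_le_faceE[OF _ _ le] by metis
  have "rcosets\<^bsub>G\<lparr>carrier := R i\<rparr>\<^esub> (R (-1)) = (\<lambda>v. R (-1) #> v) ` R i"
    by (auto simp: RCOSETS_def r_coset_def)
  then show ?thesis
    unfolding g(2,3) faces_between[OF i g(1)]
    using image_eqpoll_image[OF face_R_eq_iff[OF i g(1)]] by simp
qed

end

section \<open>Sections, facets, vertex-figures and the index count\<close>

theorem theorem4p2:
  fixes G :: "('a, 'b) monoid_scheme" and R :: "int \<Rightarrow> 'a set" and n :: int
  assumes "1 \<le> n" and "generalized_string_C_group G R n"
  shows
    "(\<forall>i j. \<forall>F\<in>faces_of_rank G R n i. \<forall>H\<in>faces_of_rank G R n j.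
        -1 \<le> i \<and> i < j - 1 \<and> j - 1 \<le> n - 1 \<and> F \<sqsubseteq>\<^bsub>coset_complex G R n\<^esub> H \<longrightarrow>
        (let \<Lambda> = G\<lparr>carrier := gen_subgp G R {i + 1..j - 1}\<rparr>;
             R' = (\<lambda>k. if k = -1 then R (-1) else if k = j - i - 1 then R n else R (i + 1 + k))
         in generalized_string_C_group \<Lambda> R' (j - i - 1) \<and>
            order_isomorphic (poset_section (coset_complex G R n) F H)
              (coset_complex \<Lambda> R' (j - i - 1))))
     \<and>
     (let \<Lambda> = G\<lparr>carrier := gen_subgp G R ({-1..n - 2} \<union> {n})\<rparr>;
          R' = (\<lambda>k. if k = n - 1 then R n else R k)
      in generalized_string_C_group \<Lambda> R' (n - 1) \<and>
         regular_incidence_complex (coset_complex \<Lambda> R' (n - 1)) fst (n - 1) \<and>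
         (\<forall>F\<in>faces_of_rank G R n (n - 1).
            order_isomorphic (poset_section (coset_complex G R n) (least_face G) F)
              (coset_complex \<Lambda> R' (n - 1))))
     \<and>
     (let \<Lambda> = G\<lparr>carrier := gen_subgp G R ({-1} \<union> {1..n})\<rparr>;
          R' = (\<lambda>k. if k = -1 then R (-1) else R (k + 1))
      in generalized_string_C_group \<Lambda> R' (n - 1) \<and>
         regular_incidence_complex (coset_complex \<Lambda> R' (n - 1)) fst (n - 1) \<and>
         (\<forall>F\<in>faces_of_rank G R n 0.
            order_isomorphic (poset_section (coset_complex G R n) F (greatest_face G n))
              (coset_complex \<Lambda> R' (n - 1))))
     \<and>
     (\<forall>i\<in>{0..n - 1}. \<forall>F\<in>faces_of_rank G R n (i - 1). \<forall>H\<in>faces_of_rank G R n (i + 1).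
        F \<sqsubseteq>\<^bsub>coset_complex G R n\<^esub> H \<longrightarrow>
        {E \<in> faces_of_rank G R n i.
            F \<sqsubseteq>\<^bsub>coset_complex G R n\<^esub> E \<and> E \<sqsubseteq>\<^bsub>coset_complex G R n\<^esub> H}
          \<approx> rcosets\<^bsub>G\<lparr>carrier := R i\<rparr>\<^esub> (R (-1)))"
proof -
  interpret generalized_string_C_group G R n by fact
  have string_and_regular: "generalized_string_C_group (section_group i j) (section_R i j) (j - i - 1)"
      "regular_incidence_complex (coset_complex (section_group i j) (section_R i j) (j - i - 1)) fst (j - i - 1)"
    if "i \<in> {-1..n}" "j \<in> {-1..n}" "i < j" for i j
    using section_string_C_group[OF that] generalized_string_C_group.complex_regular by blast+
  \<comment> \<open>The three groups are given by index sets that differ from an open interval only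
    outside \<open>{0..n - 1}\<close>.\<close>
  have a: "\<Lambda> = section_group i j"
    if "\<Lambda> = G\<lparr>carrier := gen_subgp G R I\<rparr>" "I \<subseteq> {-1..n}" "I \<inter> {0..n - 1} = {i<..<j} \<inter> {0..n - 1}" for \<Lambda> i j I
    using that gen_subgp_eq_std[of I] std_cong[of I "{i<..<j}"] by (simp add: section_group_def)
  have 1: "G\<lparr>carrier := gen_subgp G R {i + 1..j - 1}\<rparr> = section_group i j"
    if "i \<in> {-1..n}" "j \<in> {-1..n}" for i j
    using that by (intro a[OF refl]) auto
  have 2: "G\<lparr>carrier := gen_subgp G R ({-1..n - 2} \<union> {n})\<rparr> = section_group (-1) (n - 1)"
    using \<open>1 \<le> n\<close> by (intro a[OF refl]) auto
  have 3: "G\<lparr>carrier := gen_subgp G R ({-1} \<union> {1..n})\<rparr> = section_group 0 n"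
    using \<open>1 \<le> n\<close> by (intro a[OF refl]) auto
  \<comment> \<open>Facets need the exception at \<open>k = n - 1\<close>, where the shift would
    give \<open>R (n - 1)\<close>. For vertex-figures the shift gives \<open>R n\<close> by
    itself.\<close>
  have R2: "(\<lambda>k. if k = n - 1 then R n else R k) = section_R (-1) (n - 1)"
    using \<open>1 \<le> n\<close> R_last by (intro ext) (simp add: section_R_def)
  have R3: "(\<lambda>k. if k = -1 then R (-1) else R (k + 1)) = section_R 0 n"
    by (intro ext) (simp add: section_R_def add.commute)
  have facet: "order_isomorphic (poset_section K (least_face G) F)
      (coset_complex (section_group (-1) (n - 1)) (section_R (-1) (n - 1)) (n - 1))"
    if F: "F \<in> faces_of_rank G R n (n - 1)" for F
  proof -
    obtain g where "g \<in> carrier G" "F = face (n - 1) g"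
      using F \<open>1 \<le> n\<close> by (auto simp: faces_of_rank_eq)
    then show ?thesis
      using section_isomorphic[of "-1" "n - 1" g] \<open>1 \<le> n\<close> by (simp add: least_face_eq[of g])
  qed
  have vertex: "order_isomorphic (poset_section K F (greatest_face G n))
      (coset_complex (section_group 0 n) (section_R 0 n) (n - 1))"
    if F: "F \<in> faces_of_rank G R n 0" for F
  proof -
    obtain g where "g \<in> carrier G" "F = face 0 g"
      using F \<open>1 \<le> n\<close> by (auto simp: faces_of_rank_eq)
    then show ?thesis
      using section_isomorphic[of 0 n g] \<open>1 \<le> n\<close> by (simp add: greatest_face_eq[of g])
  qed
  show ?thesis
    unfolding Let_def 2 3 R2 R3
  proof (intro conjI allI ballI impI)
    fix i j F H
    assume *: "F \<in> faces_of_rank G R n i" "H \<in> faces_of_rank G R n j"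
      "-1 \<le> i \<and> i < j - 1 \<and> j - 1 \<le> n - 1 \<and> F \<sqsubseteq>\<^bsub>K\<^esub> H"
    then have ij: "i \<in> {-1..n}" "j \<in> {-1..n}" "i < j" by auto
    show "generalized_string_C_group (G\<lparr>carrier := gen_subgp G R {i + 1..j - 1}\<rparr>)
        (\<lambda>k. if k = -1 then R (-1) else if k = j - i - 1 then R n else R (i + 1 + k)) (j - i - 1)"
      using string_and_regular(1)[OF ij] unfolding 1[OF ij(1,2)] section_R_def .
    show "order_isomorphic (poset_section K F H)
        (coset_complex (G\<lparr>carrier := gen_subgp G R {i + 1..j - 1}\<rparr>)
          (\<lambda>k. if k = -1 then R (-1) else if k = j - i - 1 then R n else R (i + 1 + k)) (j - i - 1))"
      using section_isomorphic_faces[OF ij *(1,2)] *(3) unfolding 1[OF ij(1,2)] section_R_def by blast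
  qed (use string_and_regular[of "-1" "n - 1"] string_and_regular[of 0 n] \<open>1 \<le> n\<close> facet vertex
      faces_between_eqpoll in simp_all)
qed

end
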